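(* Assume that Assumptions 1, 2 and 3 (stated in the context) hold. With $C_r>0$ from Assumption 1, choose $0<\varepsilon<\varepsilon_W$ such that $G(C_r)+\varepsilon$ belongs to the domain of $G^{-1}$, where $G(\lambda)=\int_\xi^\lambda \frac{ds}{\mathcal{G}(s)}$ and $\mathcal{G}$ is the function in the bound $\|\mathcal{U}'(W)\|_{\mathcal{L}(\mathbb{W},\mathbb{U})}\le\mathcal{G}(\|\mathcal{U}(W)\|_{\mathbb{U}})$. Then $\varepsilon$ is independent of $\boldsymbol{y}$, and the set $\mathcal{H}(\boldsymbol{y})$ (an open set with properties (H-a)--(H-d) of the context) can be chosen as $\mathcal{H}(\boldsymbol{y})=B_\varepsilon(W(\boldsymbol{y}))$ for all $\boldsymbol{y}\in\mathcal{X}_{\mathbb{R}}$. Moreover, $\mathcal{U}$ is uniformly bounded on $B_\varepsilon(W(\boldsymbol{y}))$ by a constant $C_\varepsilon>0$ that depends only on $\varepsilon$.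
   Context: Setting. $\mathcal{X}_{\mathbb{R}}$ is a separable Banach space of real sequences, $\mathbb{W}_{\mathbb{R}},\mathbb{U}_{\mathbb{R}},R$ are Banach spaces, $\boldsymbol{y}\mapsto W(\boldsymbol{y})$ maps $\mathcal{X}_{\mathbb{R}}$ into $\mathbb{W}_{\mathbb{R}}$, and $\mathcal{R}:\mathbb{W}_{\mathbb{R}}\times\mathbb{U}_{\mathbb{R}}\to R$ is a given (residual) operator. $\mathcal{L}(X,Y)$ denotes the bounded linear operators from $X$ to $Y$ with the operator norm. Assumption 1. For any $\boldsymbol{y}\in\mathcal{X}_{\mathbb{R}}$ there exists $u(\boldsymbol{y})\in\mathbb{U}_{\mathbb{R}}$ such that $\mathcal{R}(W(\boldsymbol{y}),u(\boldsymbol{y}))=0$ in $R$. Moreover there exists $C_r>0$ such that $\|u(\boldsymbol{y})\|_{\mathbb{U}_{\mathbb{R}}}\le C_r$ for all $\boldsymbol{y}\in\mathcal{X}_{\mathbb{R}}$. Assumption 2. $\mathcal{R}$ extends to complex Banach spaces $\mathbb{W}\supset\mathbb{W}_{\mathbb{R}}$, $\mathbb{U}\supset\mathbb{U}_{\mathbb{R}}$, and the extension $\mathcal{R}:\mathbb{W}\times\mathbb{U}\to R$ satisfies: (i) $\mathcal{R}$ is Fréchet continuously differentiable; (ii) $\partial_u\mathcal{R}(W,u):\mathbb{U}\to R$ is a homeomorphism for all $(W,u)\in\mathbb{W}_{\mathbb{R}}\times\mathbb{U}_{\mathbb{R}}$ with $\mathcal{R}(W,u)=0$. Notation: $B_\varrho(W_0)=\{W\in\mathbb{W}:\|W-W_0\|_{\mathbb{W}}<\varrho\}$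 and $B_\varrho(u_0)=\{u\in\mathbb{U}:\|u-u_0\|_{\mathbb{U}}<\varrho\}$. Solution operator. By the implicit function theorem, for every $\boldsymbol{y}\in\mathcal{X}_{\mathbb{R}}$ there are $\varepsilon(\boldsymbol{y})>0$ and a holomorphic map $\mathcal{U}:B_{\varepsilon(\boldsymbol{y})}(W(\boldsymbol{y}))\to\mathbb{U}$ with $\mathcal{U}(W(\boldsymbol{y}))=u(\boldsymbol{y})$ and $\mathcal{R}(W,\mathcal{U}(W))=0$ for all $W$ in this ball; its derivative is $\mathcal{U}'(W)=-\partial_u\mathcal{R}(W,\mathcal{U}(W))^{-1}\circ\partial_W\mathcal{R}(W,\mathcal{U}(W))$. The radius $\varepsilon(\boldsymbol{y})$ may be decreased freely; without loss of generality $\varepsilon(\boldsymbol{y})\le\varepsilon_W$ with $\varepsilon_W$ from Assumption 3. Holomorphic extensions of $\mathcal{U}$ are still denoted by $\mathcal{U}$. Assumption 3. There exist $\varepsilon_W,\varepsilon_u>0$ such that for any $\boldsymbol{y}\in\mathcal{X}_{\mathbb{R}}$ and any $W\in B_{\varepsilon_W}(W(\boldsymbol{y}))$ with $\mathcal{U}(W)\in B_{\varepsilon_u}(\mathcal{U}(W(\boldsymbol{y})))$, the operator $\partial_W\mathcal{R}(W,\mathcal{U}(W))$ is well-defined and $\partial_u\mathcal{R}(W,\mathcal{U}(W))$ is a homeomorphism, with $$\|\partial_W\mathcal{R}(W,\mathcal{U}(W))\|_{\mathcal{L}(\mathbb{W},R)}\le\mathcal{G}_1(\|\mathcal{U}(W)\|_{\mathbb{U}}),\qquad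 \|\partial_u\mathcal{R}(W,\mathcal{U}(W))^{-1}\|_{\mathcal{L}(R,\mathbb{U})}\le\mathcal{G}_2(\|\mathcal{U}(W)\|_{\mathbb{U}}),$$ where $\mathcal{G}_1,\mathcal{G}_2$ are continuous, may depend on problem coefficients and on $\varepsilon_u,\varepsilon_W$, depend on $W$ and $\mathcal{U}(W)$ only through $\|\mathcal{U}(W)\|_{\mathbb{U}}$, and are independent of $\boldsymbol{y}$. Consequently there is a continuous increasing function $\mathcal{G}>0$ with $\|\mathcal{U}'(W)\|_{\mathcal{L}(\mathbb{W},\mathbb{U})}\le\mathcal{G}(\|\mathcal{U}(W)\|_{\mathbb{U}})$ for all $W\in B_{\min(\varepsilon(\boldsymbol{y}),\varepsilon_W)}(W(\boldsymbol{y}))$ (and wherever Assumption 3 applies). Fix $\xi>0$ (with $C_r>\xi$, so that $G(C_r)$ is defined) and set $G(\lambda)=\int_\xi^\lambda\frac{ds}{\mathcal{G}(s)}$ for $\lambda>\xi$. The set $\mathcal{H}(\boldsymbol{y})$. For fixed $\boldsymbol{y}\in\mathcal{X}_{\mathbb{R}}$, $\mathcal{H}(\boldsymbol{y})\subseteq B_{\varepsilon_W}(W(\boldsymbol{y}))$ denotes an open set such that: (H-a) $B_{\varepsilon(\boldsymbol{y})}(W(\boldsymbol{y}))\subseteq\mathcal{H}(\boldsymbol{y})$; (H-b) $\mathcal{U}(W)\in B_{\varepsilon_u}(\mathcal{U}(W(\boldsymbol{y})))$ for all $W\in\mathcal{H}(\boldsymbol{y})$; (H-c) $\mathcal{U}:B_{\varepsilon(\boldsymbol{y})}(W(\boldsymbol{y}))\to\mathbb{U}$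 extends holomorphically to $\mathcal{H}(\boldsymbol{y})$; (H-d) for all $W\in\mathcal{H}(\boldsymbol{y})$ and $0\le\sigma\le1$, $\sigma W+(1-\sigma)W(\boldsymbol{y})\in\mathcal{H}(\boldsymbol{y})$.
   Formalization: The choice of ε also requires G(C_r)+ε ≤ G(C_r+ε_u); without it (H-b) can fail, e.g. R(W,u)=u−W on ℂ with W(y)=u(y)=0, 𝒢=1, ε_W=10, ε_u=1, ε=5. Such ε are shown to exist. *)

theory Defs
  imports "HOL-Analysis.Analysis"
begin

class complex_banach = banach +
  fixes scaleC :: "complex \<Rightarrow> 'a \<Rightarrow> 'a"  (infixr \<open>*\<^sub>C\<close> 75)
  assumes scaleC_add_right: "c *\<^sub>C (x + y) = c *\<^sub>C x + c *\<^sub>C y"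
    and scaleC_add_left: "(c + d) *\<^sub>C x = c *\<^sub>C x + d *\<^sub>C x"
    and scaleC_scaleC: "c *\<^sub>C d *\<^sub>C x = (c * d) *\<^sub>C x"
    and scaleC_of_real: "complex_of_real r *\<^sub>C x = r *\<^sub>R x"
    and norm_scaleC: "norm (c *\<^sub>C x) = cmod c * norm x"

instantiation complex :: complex_banach
begin
definition scaleC_complex :: "complex \<Rightarrow> complex \<Rightarrow> complex"
  where "scaleC_complex c x = c * x"
instance
  by standard
    (simp_all add: scaleC_complex_def algebra_simps norm_mult scaleR_conv_of_real)
end

instantiation prod :: (complex_banach, complex_banach) complex_banach
begin
definition scaleC_prod :: "complex \<Rightarrow> 'a \<times> 'b \<Rightarrow> 'a \<times> 'b"
  where "scaleC_prod c p = (c *\<^sub>C fst p, c *\<^sub>C snd p)"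
instance
proof
  fix c d :: complex and r :: real and x y :: "'a \<times> 'b"
  show "c *\<^sub>C (x + y) = c *\<^sub>C x + c *\<^sub>C y" "(c + d) *\<^sub>C x = c *\<^sub>C x + d *\<^sub>C x"
    "c *\<^sub>C d *\<^sub>C x = (c * d) *\<^sub>C x" "complex_of_real r *\<^sub>C x = r *\<^sub>R x"
    by (simp_all add: scaleC_prod_def scaleC_add_right scaleC_add_left scaleC_scaleC
        scaleC_of_real prod_eq_iff)
  show "norm (c *\<^sub>C x) = cmod c * norm x"
    by (simp add: scaleC_prod_def norm_prod_def norm_scaleC power_mult_distrib
        distrib_left [symmetric] real_sqrt_mult)
qed
end

definition complex_linear :: "('a::complex_banach \<Rightarrow> 'b::complex_banach) \<Rightarrow> bool"
  where "complex_linear f \<longleftrightarrow> linear f \<and> (\<forall>c x. f (c *\<^sub>C x) = c *\<^sub>C f x)"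

text \<open>Intended for open \<open>S\<close>: complex Frechet differentiability at every point of \<open>S\<close>.\<close>

definition holomorphic_map_on ::
    "('a::complex_banach \<Rightarrow> 'b::complex_banach) \<Rightarrow> 'a set \<Rightarrow> bool"
  where "holomorphic_map_on f S \<longleftrightarrow>
    (\<forall>x\<in>S. \<exists>D. (f has_derivative D) (at x) \<and> complex_linear D)"

definition continuously_complex_differentiable ::
    "('a::complex_banach \<Rightarrow> 'b::complex_banach) \<Rightarrow> bool"
  where "continuously_complex_differentiable f \<longleftrightarrow>
    (\<exists>f' :: 'a \<Rightarrow> 'a \<Rightarrow>\<^sub>L 'b.
       (\<forall>x. (f has_derivative blinfun_apply (f' x)) (at x) \<and> complex_linear (blinfun_apply (f' x))) \<and>
       continuous_on UNIV f')"

definition partial_W ::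
    "('w::complex_banach \<times> 'u::complex_banach \<Rightarrow> 'r::complex_banach) \<Rightarrow> 'w \<Rightarrow> 'u \<Rightarrow> 'w \<Rightarrow> 'r"
  where "partial_W \<R> W v = frechet_derivative (\<lambda>w. \<R> (w, v)) (at W)"

definition partial_u ::
    "('w::complex_banach \<times> 'u::complex_banach \<Rightarrow> 'r::complex_banach) \<Rightarrow> 'w \<Rightarrow> 'u \<Rightarrow> 'u \<Rightarrow> 'r"
  where "partial_u \<R> W v = frechet_derivative (\<lambda>z. \<R> (W, z)) (at v)"

text \<open>
  The separable Banach space of real sequences is a type \<open>'x\<close> of class \<open>banach\<close> and
  \<open>second_countable_topology\<close> (for metric spaces: separable), whose elements are identified
  with real sequences through the injective linear map \<open>coord\<close>.
\<close>

definition sequence_space :: "('x::real_vector \<Rightarrow> nat \<Rightarrow> real) \<Rightarrow> bool"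
  where "sequence_space coord \<longleftrightarrow> inj coord \<and> (\<forall>n. linear (\<lambda>y. coord y n))"

text \<open>
  The real Banach spaces contained in the complex ones are closed real subspaces,
  carrying the restricted norm.
\<close>

definition real_banach_subspace :: "'a::complex_banach set \<Rightarrow> bool"
  where "real_banach_subspace S \<longleftrightarrow> subspace S \<and> closed S"

definition assumption1 ::
    "('w::complex_banach \<times> 'u::complex_banach \<Rightarrow> 'r::complex_banach) \<Rightarrow> 'u set \<Rightarrow>
     ('x \<Rightarrow> 'w) \<Rightarrow> ('x \<Rightarrow> 'u) \<Rightarrow> real \<Rightarrow> bool"
  where "assumption1 \<R> U\<^sub>R Wy u C\<^sub>r \<longleftrightarrow>
    C\<^sub>r > 0 \<and> (\<forall>y. u y \<in> U\<^sub>R \<and> \<R> (Wy y, u y) = 0 \<and> norm (u y) \<le> C\<^sub>r)"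

definition assumption2 ::
    "('w::complex_banach \<times> 'u::complex_banach \<Rightarrow> 'r::complex_banach) \<Rightarrow>
     'w set \<Rightarrow> 'u set \<Rightarrow> bool"
  where "assumption2 \<R> W\<^sub>R U\<^sub>R \<longleftrightarrow>
    continuously_complex_differentiable \<R> \<and>
    (\<forall>W\<in>W\<^sub>R. \<forall>v\<in>U\<^sub>R. \<R> (W, v) = 0 \<longrightarrow>
       homeomorphism UNIV UNIV (partial_u \<R> W v) (inv (partial_u \<R> W v)))"

text \<open>
  The local solution operator at the parameter \<open>y\<close> is \<open>\<U> y\<close>, on the ball of radius \<open>\<epsilon>\<^sub>y y\<close>
  around \<open>Wy y\<close>. It is indexed by \<open>y\<close> because the branches belonging to different
  parameters need not agree where their balls overlap.
\<close>

definition solution_operator ::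
    "('w::complex_banach \<times> 'u::complex_banach \<Rightarrow> 'r::complex_banach) \<Rightarrow>
     ('x \<Rightarrow> 'w) \<Rightarrow> ('x \<Rightarrow> 'u) \<Rightarrow> ('x \<Rightarrow> real) \<Rightarrow> ('x \<Rightarrow> 'w \<Rightarrow> 'u) \<Rightarrow> bool"
  where "solution_operator \<R> Wy u \<epsilon>\<^sub>y \<U> \<longleftrightarrow>
    (\<forall>y. \<epsilon>\<^sub>y y > 0 \<and>
         holomorphic_map_on (\<U> y) (ball (Wy y) (\<epsilon>\<^sub>y y)) \<and>
         \<U> y (Wy y) = u y \<and>
         (\<forall>W\<in>ball (Wy y) (\<epsilon>\<^sub>y y). \<R> (W, \<U> y W) = 0))"

text \<open>
  \<open>V\<close> is a holomorphic extension of \<open>\<U>0\<close> from \<open>ball W0 e\<close> to the open set \<open>H\<close>, which is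
  star-shaped about \<open>W0\<close>; by the identity theorem \<open>V\<close> is then unique on \<open>H\<close>.
\<close>

definition star_extension ::
    "'w::complex_banach \<Rightarrow> real \<Rightarrow> ('w \<Rightarrow> 'u::complex_banach) \<Rightarrow> 'w set \<Rightarrow> ('w \<Rightarrow> 'u) \<Rightarrow> bool"
  where "star_extension W0 e \<U>0 H V \<longleftrightarrow>
    open H \<and> ball W0 e \<subseteq> H \<and>
    holomorphic_map_on V H \<and> (\<forall>W\<in>ball W0 e. V W = \<U>0 W) \<and>
    (\<forall>W\<in>H. \<forall>\<sigma>\<in>{0..1}. \<sigma> *\<^sub>R W + (1 - \<sigma>) *\<^sub>R W0 \<in> H)"

text \<open>
  The points \<open>W\<close> within \<open>\<epsilon>\<^sub>W\<close> of \<open>Wy y\<close>, together with the value \<open>v\<close> there of a holomorphic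
  extension of \<open>\<U> y\<close>, such that \<open>v\<close> is within \<open>\<epsilon>\<^sub>u\<close> of \<open>\<U> y (Wy y)\<close>. The extension \<open>V\<close>
  itself is a parameter, so that its derivative can be referred to. The initial radius may
  be any \<open>e \<le> \<epsilon>\<^sub>y y\<close>, since the radius in the implicit function theorem may be decreased.
\<close>

definition in_scope ::
    "('x \<Rightarrow> 'w::complex_banach) \<Rightarrow> ('x \<Rightarrow> real) \<Rightarrow> ('x \<Rightarrow> 'w \<Rightarrow> 'u::complex_banach) \<Rightarrow>
     real \<Rightarrow> real \<Rightarrow> 'x \<Rightarrow> ('w \<Rightarrow> 'u) \<Rightarrow> 'w \<Rightarrow> bool"
  where "in_scope Wy \<epsilon>\<^sub>y \<U> \<epsilon>\<^sub>W \<epsilon>\<^sub>u y V W \<longleftrightarrow>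
    (\<exists>e H. 0 < e \<and> e \<le> \<epsilon>\<^sub>y y \<and> H \<subseteq> ball (Wy y) \<epsilon>\<^sub>W \<and>
       star_extension (Wy y) e (\<U> y) H V \<and> W \<in> H) \<and>
    V W \<in> ball (\<U> y (Wy y)) \<epsilon>\<^sub>u"

definition assumption3 ::
    "('w::complex_banach \<times> 'u::complex_banach \<Rightarrow> 'r::complex_banach) \<Rightarrow>
     ('x \<Rightarrow> 'w) \<Rightarrow> ('x \<Rightarrow> real) \<Rightarrow> ('x \<Rightarrow> 'w \<Rightarrow> 'u) \<Rightarrow>
     real \<Rightarrow> real \<Rightarrow> (real \<Rightarrow> real) \<Rightarrow> (real \<Rightarrow> real) \<Rightarrow> bool"
  where "assumption3 \<R> Wy \<epsilon>\<^sub>y \<U> \<epsilon>\<^sub>W \<epsilon>\<^sub>u \<G>\<^sub>1 \<G>\<^sub>2 \<longleftrightarrow>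
    \<epsilon>\<^sub>W > 0 \<and> \<epsilon>\<^sub>u > 0 \<and> continuous_on {0..} \<G>\<^sub>1 \<and> continuous_on {0..} \<G>\<^sub>2 \<and>
    (\<forall>y V W. in_scope Wy \<epsilon>\<^sub>y \<U> \<epsilon>\<^sub>W \<epsilon>\<^sub>u y V W \<longrightarrow>
       (\<lambda>w. \<R> (w, V W)) differentiable (at W) \<and>
       homeomorphism UNIV UNIV (partial_u \<R> W (V W)) (inv (partial_u \<R> W (V W))) \<and>
       onorm (partial_W \<R> W (V W)) \<le> \<G>\<^sub>1 (norm (V W)) \<and>
       onorm (inv (partial_u \<R> W (V W))) \<le> \<G>\<^sub>2 (norm (V W)))"

definition derivative_bound ::
    "('x \<Rightarrow> 'w::complex_banach) \<Rightarrow> ('x \<Rightarrow> real) \<Rightarrow> ('x \<Rightarrow> 'w \<Rightarrow> 'u::complex_banach) \<Rightarrow>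
     real \<Rightarrow> real \<Rightarrow> (real \<Rightarrow> real) \<Rightarrow> bool"
  where "derivative_bound Wy \<epsilon>\<^sub>y \<U> \<epsilon>\<^sub>W \<epsilon>\<^sub>u \<G> \<longleftrightarrow>
    continuous_on {0..} \<G> \<and> mono_on {0..} \<G> \<and> (\<forall>s\<ge>0. \<G> s > 0) \<and>
    (\<forall>y. \<forall>W\<in>ball (Wy y) (min (\<epsilon>\<^sub>y y) \<epsilon>\<^sub>W).
       onorm (frechet_derivative (\<U> y) (at W)) \<le> \<G> (norm (\<U> y W))) \<and>
    (\<forall>y V W. in_scope Wy \<epsilon>\<^sub>y \<U> \<epsilon>\<^sub>W \<epsilon>\<^sub>u y V W \<longrightarrow>
       onorm (frechet_derivative V (at W)) \<le> \<G> (norm (V W)))"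

definition G_int :: "(real \<Rightarrow> real) \<Rightarrow> real \<Rightarrow> real \<Rightarrow> real"
  where "G_int \<G> \<xi> l = integral {\<xi>..l} (\<lambda>s. 1 / \<G> s)"

text \<open>
  The domain of the inverse of \<open>G_int \<G> \<xi>\<close> is its range over \<open>{\<xi><..}\<close>. This condition alone
  does not keep the solution within \<open>\<epsilon>\<^sub>u\<close> of \<open>u y\<close>, which is where \<open>\<G>\<close> bounds the derivative:
  for \<open>\<R> (W, v) = v - k * W\<close> on the complex plane with \<open>k > 0\<close> and \<open>Wy\<close>, \<open>u\<close> zero, the
  constant \<open>\<G> = k\<close> makes every positive \<open>\<epsilon> < \<epsilon>\<^sub>W\<close> admissible, but the solution \<open>k * W\<close> leaves
  \<open>ball 0 \<epsilon>\<^sub>u\<close> on \<open>ball 0 \<epsilon>\<close> if \<open>\<epsilon>\<^sub>u < k * \<epsilon>\<close>. It has to be combined with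
  \<open>G_int \<G> \<xi> C\<^sub>r + \<epsilon> \<le> G_int \<G> \<xi> (C\<^sub>r + \<epsilon>\<^sub>u)\<close>, that is, the inverse at \<open>G_int \<G> \<xi> C\<^sub>r + \<epsilon>\<close>
  is at most \<open>C\<^sub>r + \<epsilon>\<^sub>u\<close>, the bound on the norms of the points within \<open>\<epsilon>\<^sub>u\<close> of some \<open>u y\<close>.
\<close>

definition admissible_radius :: "(real \<Rightarrow> real) \<Rightarrow> real \<Rightarrow> real \<Rightarrow> real \<Rightarrow> real \<Rightarrow> bool"
  where "admissible_radius \<G> \<xi> C\<^sub>r \<epsilon>\<^sub>W \<epsilon> \<longleftrightarrow>
    0 < \<epsilon> \<and> \<epsilon> < \<epsilon>\<^sub>W \<and> G_int \<G> \<xi> C\<^sub>r + \<epsilon> \<in> G_int \<G> \<xi> ` {\<xi><..}"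

text \<open>
  The conditions on the set \<open>H\<close> for one parameter, with centre \<open>W0\<close>, local solution operator
  \<open>\<U>0\<close> on \<open>ball W0 e\<close>, and extension \<open>V\<close>.
\<close>

definition is_H_set ::
    "'w::complex_banach \<Rightarrow> real \<Rightarrow> real \<Rightarrow> real \<Rightarrow> ('w \<Rightarrow> 'u::complex_banach) \<Rightarrow>
     'w set \<Rightarrow> ('w \<Rightarrow> 'u) \<Rightarrow> bool"
  where "is_H_set W0 \<epsilon>\<^sub>W \<epsilon>\<^sub>u e \<U>0 H V \<longleftrightarrow>
    H \<subseteq> ball W0 \<epsilon>\<^sub>W \<and>
    star_extension W0 e \<U>0 H V \<and>
    (\<forall>W\<in>H. V W \<in> ball (V W0) \<epsilon>\<^sub>u)"

end

theory Submission
  imports Defs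
begin

text \<open>
Fix a parameter and write \<open>W0\<close> for the centre and \<open>u0\<close> for the solution there, so that
  \<open>norm u0 \<le> C\<^sub>r\<close>. Two facts carry the proof.

  \<^emph>\<open>An extension cannot leave the \<open>\<epsilon>\<^sub>u\<close>-ball.\<close> Let \<open>V\<close> extend the local solution operator to a set
  that is star-shaped about \<open>W0\<close> and lies in \<open>ball W0 \<epsilon>\<close>. Along a ray of length \<open>k < \<epsilon>\<close>,
  the displacement \<open>r t = norm (V (W0 + t (W - W0)) - u0)\<close> grows at most at the rate \<open>k * \<G> (C\<^sub>r + r t)\<close>
  as long as it is below \<open>\<epsilon>\<^sub>u\<close>. Since \<open>1 / \<G>\<close> is the derivative of \<open>G_int\<close>,
  the quantity \<open>G_int \<G> \<xi> (C\<^sub>r + r t)\<close> then grows at most at the rate \<open>k\<close>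
  (\<open>growth_comparison\<close>). To reach \<open>r t = \<epsilon>\<^sub>u\<close> it would have to exceed \<open>G_int \<G> \<xi> C\<^sub>r\<close> by
  \<open>\<epsilon>\<close> or more, which is impossible (\<open>growth_confinement\<close>). So the bounds on the derivative of
  \<open>V\<close> and on the inverse of the partial derivative of the residual hold on all of that set,
  with constants that are uniform in the parameter, because the norm of \<open>V\<close> is at most \<open>C\<^sub>r + \<epsilon>\<^sub>u\<close>.

  \<^emph>\<open>Such bounds force the extension to exist on the whole ball.\<close> Spheres in infinite dimensions are
  not compact, so the radius of a ball of existence cannot be increased step by step.
  The continuation is therefore built one ray at a time: a point \<open>W\<close> belongs to
  \<open>ray_domain\<close> if the segment from \<open>W0\<close> to \<open>W\<close> lifts to a continuous path of zeros at which
  the partial derivative in the second variable is invertible. Lifts are unique, and initial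
  parts of a lift are lifts, so the end points define one function \<open>continuation\<close> on a
  star-shaped set. A segment is compact, so the local solvability of the equation is uniform along
  a lift, which makes \<open>ray_domain\<close> open and \<open>continuation\<close> continuous
  (\<open>lifted_ray_perturb\<close>). Implicit differentiation then makes it holomorphic. Hence
  its restriction to \<open>ball W0 \<epsilon>\<close> is one of the extensions covered by the first fact.
  The derivative bound gives a limit of the continuation at the end of every ray, and the bound on the
  inverses keeps the partial derivative invertible in the limit (\<open>limit_of_regular_rays\<close>).
  So the part of a ray inside \<open>ray_domain\<close> is closed as well as open, and
  \<open>ball W0 \<epsilon> \<subseteq> ray_domain\<close> (\<open>ball_subset_ray_domain\<close>).
\<close>

section \<open>Approximately linear maps\<close>

definition blinfun_inverse :: "('a::real_normed_vector \<Rightarrow>\<^sub>L 'b::real_normed_vector) \<Rightarrow> ('b \<Rightarrow>\<^sub>L 'a) \<Rightarrow> bool"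
  where "blinfun_inverse A B \<longleftrightarrow> (\<forall>x. B (A x) = x) \<and> (\<forall>y. A (B y) = y)"

text \<open>A quantitative Newton step, in the form of a contraction: with the inverse \<open>B\<close> frozen, the map
  \<open>x \<mapsto> x - B (g x)\<close> halves distances on the ball, and the bound on \<open>g x0\<close> makes it map the ball into
  itself. It yields both the solutions of the nonlinear equation and the
  stability of invertibility.\<close>

lemma approximately_linear_zero:
  fixes g :: "'a::banach \<Rightarrow> 'b::real_normed_vector"
  assumes AB: "blinfun_inverse A B" and b: "norm B \<le> b" "0 < b"
    and r: "0 \<le> r"
    and lin: "\<And>x x'. x \<in> cball x0 r \<Longrightarrow> x' \<in> cball x0 r \<Longrightarrow>
      norm (g x - g x' - A (x - x')) \<le> norm (x - x') / (2 * b)"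
    and small: "norm (g x0) \<le> r / (2 * b)"
  shows "\<exists>x\<in>cball x0 r. g x = 0"
proof -
  have BA: "\<And>x. B (A x) = x" and AB': "\<And>y. A (B y) = y"
    using AB by (auto simp: blinfun_inverse_def)
  define T where "T x = x - B (g x)" for x
  have B_le: "norm (B y) \<le> b * norm y" for y
    using norm_blinfun[of B y] b(1) by (meson mult_right_mono norm_ge_zero order_trans)
  have contr: "norm (T x - T x') \<le> 1/2 * norm (x - x')"
    if "x \<in> cball x0 r" "x' \<in> cball x0 r" for x x'
  proof -
    have "T x - T x' = - B (g x - g x' - A (x - x'))"
      by (simp add: T_def blinfun.diff_right blinfun.add_right BA algebra_simps)
    then have "norm (T x - T x') \<le> b * norm (g x - g x' - A (x - x'))"
      using B_le by simp
    also have "\<dots> \<le> b * (norm (x - x') / (2 * b))"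
      using lin[OF that] b by (intro mult_left_mono) auto
    finally show ?thesis using b by (simp add: field_simps)
  qed
  have "T x \<in> cball x0 r" if x: "x \<in> cball x0 r" for x
  proof -
    have "norm (x0 - T x) \<le> norm (T x0 - T x) + norm (x0 - T x0)"
      by (metis add.commute norm_diff_triangle_le order_refl)
    moreover have "norm (T x0 - T x) \<le> r / 2"
      using contr[of x0 x] x r by (simp add: dist_norm)
    moreover have "norm (x0 - T x0) \<le> b * (r / (2 * b))"
      using B_le[of "g x0"] mult_left_mono[OF small, of b] b by (simp add: T_def)
    moreover have "b * (r / (2 * b)) = r / 2" using b by simp
    ultimately show ?thesis by (simp add: dist_norm)
  qed
  then have "\<exists>!x\<in>cball x0 r. T x = x"
    using contr r
    by (intro Banach_fix[where c = "1/2"]) (auto simp: dist_norm complete_eq_closed)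
  then obtain x where x: "x \<in> cball x0 r" "T x = x" by auto
  then have "B (g x) = 0" by (simp add: T_def)
  then have "g x = 0" using AB'[of "g x"] by simp
  then show ?thesis using x by blast
qed

text \<open>The radius depends on the norm of the inverse only. This uniformity is what lets invertibility
  survive in limits of invertible operators with bounded inverses. Surjectivity
  is the solvability of an approximately linear equation on a ball that grows with the right-hand side.\<close>

lemma blinfun_inverse_perturbation:
  fixes A A' :: "'a::banach \<Rightarrow>\<^sub>L 'b::real_normed_vector"
  assumes AB: "blinfun_inverse A B" and b: "norm B \<le> b" "0 < b"
    and close: "norm (A' - A) \<le> 1 / (2 * b)"
  shows "\<exists>B'. blinfun_inverse A' B'"
proof -
  have BA: "\<And>x. B (A x) = x" using AB by (auto simp: blinfun_inverse_def)
  have diff: "norm (A' x - A x) \<le> norm x / (2 * b)" for x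
    using norm_blinfun[of "A' - A" x] mult_right_mono[OF close norm_ge_zero[of x]]
    by (simp add: blinfun.diff_left)
  have lower: "norm x \<le> 2 * b * norm (A' x)" for x
  proof -
    have "norm x \<le> b * norm (A x)"
      using norm_blinfun[of B "A x"] b(1) BA by (metis mult_right_mono norm_ge_zero order_trans)
    also have "\<dots> \<le> b * (norm (A' x) + norm x / (2 * b))"
      using diff[of x] norm_triangle_sub[of "A x" "A' x"] b(2)
      by (intro mult_left_mono) (auto simp: norm_minus_commute)
    also have "\<dots> = b * norm (A' x) + norm x / 2" using b(2) by (simp add: field_simps)
    finally show ?thesis by simp
  qed
  have inj: "inj (blinfun_apply A')"
  proof (rule injI)
    fix x x' assume "A' x = A' x'"
    then have "A' (x - x') = 0" by (simp add: blinfun.diff_right)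
    then show "x = x'" using lower[of "x - x'"] by simp
  qed
  have "\<exists>x. A' x = y" for y
  proof -
    have "\<exists>x\<in>cball 0 (2 * b * norm y). A' x - y = 0"
    proof (rule approximately_linear_zero[OF AB b])
      show "norm (A' x - y - (A' x' - y) - A (x - x')) \<le> norm (x - x') / (2 * b)" for x x'
        using diff[of "x - x'"] by (simp add: blinfun.diff_right blinfun.add_right algebra_simps)
    qed (use b in auto)
    then show ?thesis by auto
  qed
  then have surj: "surj (blinfun_apply A')" by (metis surjI)
  have A'_inv: "A' (inv (blinfun_apply A') y) = y" for y
    by (rule surj_f_inv_f[OF surj])
  have "bounded_linear (inv (blinfun_apply A'))"
  proof (rule bounded_linear_intro)
    fix x y r
    show "inv (blinfun_apply A') (x + y) = inv (blinfun_apply A') x + inv (blinfun_apply A') y"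
      by (rule injD[OF inj]) (simp add: A'_inv blinfun.add_right)
    show "inv (blinfun_apply A') (r *\<^sub>R x) = r *\<^sub>R inv (blinfun_apply A') x"
      by (rule injD[OF inj]) (simp add: A'_inv blinfun.scaleR_right)
    show "norm (inv (blinfun_apply A') x) \<le> norm x * (2 * b)"
      using lower[of "inv (blinfun_apply A') x"] by (simp add: A'_inv mult.commute)
  qed
  then have "blinfun_inverse A' (Blinfun (inv (blinfun_apply A')))"
    by (simp add: blinfun_inverse_def bounded_linear_Blinfun_apply A'_inv inv_f_f[OF inj])
  then show ?thesis by blast
qed

text \<open>The inverse of a linear homeomorphism is linear and continuous at the origin, hence bounded.\<close>

lemma linear_homeomorphism_blinfun_inverse:
  fixes A :: "'a::real_normed_vector \<Rightarrow>\<^sub>L 'b::real_normed_vector"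
  assumes homeo: "homeomorphism UNIV UNIV (blinfun_apply A) (inv (blinfun_apply A))"
    and bound: "onorm (inv (blinfun_apply A)) \<le> c"
  shows "\<exists>B. norm B \<le> c \<and> blinfun_inverse A B"
proof -
  let ?i = "inv (blinfun_apply A)"
  have i: "\<And>x. ?i (A x) = x" "\<And>y. A (?i y) = y" "continuous_on UNIV ?i"
    using homeo unfolding homeomorphism_def by auto
  have add: "?i (x + y) = ?i x + ?i y" for x y by (metis i(1,2) blinfun.add_right)
  have scale: "?i (r *\<^sub>R x) = r *\<^sub>R ?i x" for r x by (metis i(1,2) blinfun.scaleR_right)
  have i0: "?i 0 = 0" by (metis i(1) blinfun.zero_right)
  have "isCont ?i 0" using i(3) continuous_on_eq_continuous_at[OF open_UNIV] by blast
  then obtain d where d: "d > 0" "\<And>y. dist y 0 < d \<Longrightarrow> dist (?i y) (?i 0) < 1"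
    unfolding continuous_at_eps_delta using zero_less_one by blast
  have "bounded_linear ?i"
  proof (rule bounded_linear_intro[OF add scale])
    fix y
    show "norm (?i y) \<le> norm y * (2 / d)"
    proof (cases "y = 0")
      case False
      define r where "r = d / (2 * norm y)"
      have r: "r > 0" using d(1) False by (simp add: r_def)
      have "norm (r *\<^sub>R y) < d" using r d(1) False by (simp add: r_def)
      then have "norm (?i (r *\<^sub>R y)) < 1" using d(2)[of "r *\<^sub>R y"] i0 by simp
      then have "r * norm (?i y) < 1" using r by (simp add: scale)
      then show ?thesis using d(1) False by (simp add: r_def field_simps)
    qed (simp add: i0)
  qed
  then have rep: "blinfun_apply (Blinfun ?i) = ?i" by (rule bounded_linear_Blinfun_apply)
  then have "norm (Blinfun ?i) \<le> c" using bound by (simp add: norm_blinfun.rep_eq)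
  moreover have "blinfun_inverse A (Blinfun ?i)"
    by (simp add: blinfun_inverse_def rep i)
  ultimately show ?thesis by blast
qed

section \<open>Zeros of a continuously differentiable map\<close>

locale C1_equation =
  fixes F :: "'w::real_normed_vector \<times> 'u::banach \<Rightarrow> 'r::real_normed_vector"
    and F' :: "'w \<times> 'u \<Rightarrow> ('w \<times> 'u) \<Rightarrow>\<^sub>L 'r"
  assumes has_derivative_F: "(F has_derivative F' z) (at z)"
    and continuous_F': "continuous_on UNIV F'"
begin

definition D_u :: "'w \<times> 'u \<Rightarrow> 'u \<Rightarrow>\<^sub>L 'r"
  where "D_u z = F' z o\<^sub>L Blinfun (\<lambda>k. (0, k))"

text \<open>The condition of the implicit function theorem, at points that need not be zeros.\<close>

definition regular :: "'w \<times> 'u \<Rightarrow> bool"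
  where "regular z \<longleftrightarrow> (\<exists>B. blinfun_inverse (D_u z) B)"

lemma bounded_linear_embed_u: "bounded_linear (\<lambda>k::'u. (0::'w, k))"
  by (intro bounded_linear_Pair bounded_linear_zero bounded_linear_ident)

lemma D_u_apply [simp]: "D_u z k = F' z (0, k)"
  by (simp add: D_u_def bounded_linear_Blinfun_apply[OF bounded_linear_embed_u])

lemma frechet_derivative_section:
  "frechet_derivative (\<lambda>v. F (w, v)) (at v) = blinfun_apply (D_u (w, v))"
proof -
  have "((\<lambda>v. F (w, v)) has_derivative (\<lambda>k. F' (w, v) (0, k))) (at v)"
    by (rule has_derivative_compose[OF _ has_derivative_F, of "\<lambda>v. (w, v)" "\<lambda>k. (0, k)"])
      (auto intro!: derivative_eq_intros)
  then show ?thesis using frechet_derivative_at D_u_apply by (metis ext)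
qed

lemma norm_D_u_diff: "norm (D_u z - D_u z') \<le> norm (F' z - F' z')"
proof (rule norm_blinfun_bound)
  fix k
  show "norm ((D_u z - D_u z') k) \<le> norm (F' z - F' z') * norm k"
    using norm_blinfun[of "F' z - F' z'" "(0, k)"] by (simp add: blinfun.diff_left)
qed simp

lemma continuous_F: "continuous_on UNIV F"
  by (intro continuous_at_imp_continuous_on ballI has_derivative_continuous[OF has_derivative_F])

lemma F'_close:
  assumes "0 < e"
  shows "\<exists>d>0. \<forall>z\<in>ball z0 d. norm (F' z - F' z0) \<le> e"
proof -
  have "isCont F' z0" using continuous_F' continuous_on_eq_continuous_at[OF open_UNIV] by blast
  then obtain d where "0 < d" "\<And>z. dist z z0 < d \<Longrightarrow> dist (F' z) (F' z0) < e"
    using assms unfolding continuous_at_eps_delta by blast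
  then show ?thesis
    by (intro exI[of _ d]) (auto simp: dist_norm norm_minus_commute less_imp_le)
qed

lemma linearization_bound:
  assumes close: "\<And>z. z \<in> ball z0 d \<Longrightarrow> norm (F' z - F' z0) \<le> e"
    and "z \<in> ball z0 d" "z' \<in> ball z0 d"
  shows "norm (F z - F z' - F' z0 (z - z')) \<le> e * norm (z - z')"
proof -
  have "norm ((F z - F' z0 z) - (F z' - F' z0 z')) \<le> e * norm (z - z')"
  proof (rule differentiable_bound[of "ball z0 d" _ "\<lambda>x. blinfun_apply (F' x - F' z0)"])
    fix x assume "x \<in> ball z0 d"
    have "((\<lambda>z. F z - F' z0 z) has_derivative (\<lambda>h. F' x h - F' z0 h)) (at x within ball z0 d)"
      by (intro has_derivative_diff has_derivative_at_withinI[OF has_derivative_F]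
          bounded_linear_imp_has_derivative blinfun.bounded_linear_right)
    moreover have "blinfun_apply (F' x - F' z0) = (\<lambda>h. F' x h - F' z0 h)"
      by (rule ext) (rule blinfun.diff_left)
    ultimately show "((\<lambda>z. F z - F' z0 z) has_derivative blinfun_apply (F' x - F' z0)) (at x within ball z0 d)"
      by metis
    show "onorm (blinfun_apply (F' x - F' z0)) \<le> e"
      using close[OF \<open>x \<in> ball z0 d\<close>] by (simp add: norm_blinfun.rep_eq)
  qed (use assms in auto)
  then show ?thesis by (simp add: blinfun.diff_right blinfun.add_right algebra_simps)
qed

text \<open>The conclusion of the implicit function theorem at \<open>(w, v)\<close> with explicit constants: existence,
  a Lipschitz bound that contains uniqueness (take \<open>w1 = w2\<close>), and invertibility nearby. The
  existence clause bounds \<open>v' - v\<close> by \<open>L * norm (w' - w)\<close> and does not ask for \<open>v'\<close> to lie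
  in \<open>ball v \<rho>\<close>. This keeps all three clauses monotone in \<open>\<rho>\<close> and
  \<open>L\<close>, so that finitely many pairs of constants can be merged.\<close>

definition locally_solvable :: "real \<Rightarrow> real \<Rightarrow> 'w \<Rightarrow> 'u \<Rightarrow> bool"
  where "locally_solvable \<rho> L w v \<longleftrightarrow>
    (\<forall>w'\<in>ball w \<rho>. \<exists>v'. F (w', v') = 0 \<and> norm (v' - v) \<le> L * norm (w' - w)) \<and>
    (\<forall>w1\<in>ball w \<rho>. \<forall>w2\<in>ball w \<rho>. \<forall>v1\<in>ball v \<rho>. \<forall>v2\<in>ball v \<rho>.
       F (w1, v1) = 0 \<longrightarrow> F (w2, v2) = 0 \<longrightarrow> norm (v1 - v2) \<le> L * norm (w1 - w2)) \<and>
    (\<forall>w'\<in>ball w \<rho>. \<forall>v'\<in>ball v \<rho>. regular (w', v'))"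

lemma locally_solvable_mono:
  assumes "locally_solvable \<rho> L w v" "\<rho>' \<le> \<rho>" "L \<le> L'"
  shows "locally_solvable \<rho>' L' w v"
proof -
  have sub: "ball w \<rho>' \<subseteq> ball w \<rho>" "ball v \<rho>' \<subseteq> ball v \<rho>"
    using assms(2) by (auto intro: subset_ball)
  have "L * norm x \<le> L' * norm x" for x :: 'w
    using assms(3) by (simp add: mult_right_mono)
  then show ?thesis
    using assms(1) sub unfolding locally_solvable_def by (meson order_trans subsetD)
qed

lemma norm_Pair_diff_le: "norm ((a, b) - (c, d)) \<le> norm (a - c) + norm (b - d)"
  using norm_Pair_le[of "a - c" "b - d"] by simp

text \<open>The same \<open>\<rho>\<close> and \<open>L\<close> serve all zeros near a given regular one, because they come from a
  single neighbourhood in which \<open>F'\<close> is almost constant. This is the form that a compactness argument can use.\<close>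

lemma regular_zero_locally_solvable:
  assumes "regular (w0, v0)"
  shows "\<exists>\<sigma>>0. \<exists>\<rho>>0. \<exists>L\<ge>0. \<forall>w v. F (w, v) = 0 \<longrightarrow> (w, v) \<in> ball (w0, v0) \<sigma> \<longrightarrow>
    locally_solvable \<rho> L w v"
proof -
  let ?z0 = "(w0, v0)"
  obtain B where AB: "blinfun_inverse (D_u ?z0) B" using assms unfolding regular_def by blast
  define b where "b = norm B + 1"
  have b: "norm B \<le> b" "0 < b" by (auto simp: b_def add_nonneg_pos)
  obtain \<tau> where "\<tau> > 0" and \<tau>: "\<And>z. z \<in> ball ?z0 \<tau> \<Longrightarrow> norm (F' z - F' ?z0) \<le> 1 / (2 * b)"
    using F'_close[of "1 / (2 * b)" ?z0] b by auto
  define L where "L = 2 * b * norm (F' ?z0) + 1"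
  have "L \<ge> 1" using b by (simp add: L_def)
  \<comment> \<open>The zero over a point within \<open>\<rho>\<close> is then displaced by at most \<open>L * \<rho> = \<tau> / 4\<close>, and \<open>\<tau> / 2 + \<tau> / 4 + \<tau> / 4 = \<tau>\<close>.\<close>
  define \<rho> where "\<rho> = \<tau> / (4 * L)"
  have \<rho>: "0 < \<rho>" "\<rho> \<le> \<tau> / 4" "L * \<rho> = \<tau> / 4"
    using \<open>\<tau> > 0\<close> \<open>L \<ge> 1\<close> by (auto simp: \<rho>_def field_simps)
  have lin: "norm (F z - F z' - F' ?z0 (z - z')) \<le> norm (z - z') / (2 * b)"
    if "z \<in> ball ?z0 \<tau>" "z' \<in> ball ?z0 \<tau>" for z z'
    using linearization_bound[OF \<tau> that] by simp
  \<comment> \<open>The linear part of the equation determines \<open>v1 - v2\<close> up to half its own norm.\<close>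
  have lip: "norm (v1 - v2) \<le> L * norm (w1 - w2)"
    if "(w1, v1) \<in> ball ?z0 \<tau>" "(w2, v2) \<in> ball ?z0 \<tau>" "F (w1, v1) = 0" "F (w2, v2) = 0"
    for w1 w2 v1 v2
  proof -
    have "norm (F' ?z0 (w1 - w2, v1 - v2)) \<le> norm (w1 - w2, v1 - v2) / (2 * b)"
      using lin[OF that(1,2)] that(3,4) by simp
    also have "\<dots> \<le> (norm (w1 - w2) + norm (v1 - v2)) / (2 * b)"
      using norm_Pair_le b by (intro divide_right_mono) auto
    finally have 1: "norm (F' ?z0 (w1 - w2, v1 - v2)) \<le> (norm (w1 - w2) + norm (v1 - v2)) / (2 * b)" .
    have split: "F' ?z0 (0, v1 - v2) = F' ?z0 (w1 - w2, v1 - v2) - F' ?z0 (w1 - w2, 0)"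
      by (simp flip: blinfun.diff_right)
    have "norm (F' ?z0 (w1 - w2, 0)) \<le> norm (F' ?z0) * norm (w1 - w2)"
      using norm_blinfun[of "F' ?z0" "(w1 - w2, 0)"] by simp
    then have 2: "norm (F' ?z0 (0, v1 - v2)) \<le>
        (norm (w1 - w2) + norm (v1 - v2)) / (2 * b) + norm (F' ?z0) * norm (w1 - w2)"
      using 1 norm_triangle_ineq4[of "F' ?z0 (w1 - w2, v1 - v2)" "F' ?z0 (w1 - w2, 0)"]
      unfolding split by linarith
    have "v1 - v2 = B (F' ?z0 (0, v1 - v2))"
      using AB by (metis D_u_apply blinfun_inverse_def)
    then have "norm (v1 - v2) \<le> norm B * norm (F' ?z0 (0, v1 - v2))"
      using norm_blinfun by metis
    also have "\<dots> \<le> b * ((norm (w1 - w2) + norm (v1 - v2)) / (2 * b) + norm (F' ?z0) * norm (w1 - w2))"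
      using 2 b by (intro mult_mono) auto
    also have "\<dots> = (norm (w1 - w2) + norm (v1 - v2)) / 2 + b * norm (F' ?z0) * norm (w1 - w2)"
      using b(2) by (simp add: field_simps)
    finally show ?thesis by (simp add: L_def field_simps)
  qed
  have reg: "regular z" if "z \<in> ball ?z0 \<tau>" for z
    using blinfun_inverse_perturbation[OF AB b order_trans[OF norm_D_u_diff \<tau>[OF that]]]
    unfolding regular_def by blast
  have "locally_solvable \<rho> L w v"
    if zero: "F (w, v) = 0" and near: "(w, v) \<in> ball ?z0 (\<tau> / 2)" for w v
  proof -
    have in_ball: "(w', v') \<in> ball ?z0 \<tau>" if "norm (w' - w) < \<tau> / 4" "norm (v' - v) \<le> \<tau> / 4" for w' v'
    proof -
      have "dist ?z0 (w', v') \<le> dist ?z0 (w, v) + dist (w, v) (w', v')" by (rule dist_triangle)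
      moreover have "dist (w, v) (w', v') \<le> norm (w' - w) + norm (v' - v)"
        using norm_Pair_diff_le[of w v w' v'] by (simp add: dist_norm norm_minus_commute)
      ultimately show ?thesis using that near by simp
    qed
    have solution: "\<exists>v'. F (w', v') = 0 \<and> norm (v' - v) \<le> L * norm (w' - w)" if w': "w' \<in> ball w \<rho>" for w'
    proof -
      have nw: "norm (w' - w) < \<tau> / 4" "L * norm (w' - w) \<le> \<tau> / 4"
        using w' \<rho> mult_left_mono[of "norm (w' - w)" \<rho> L] \<open>L \<ge> 1\<close>
        by (auto simp: dist_norm norm_minus_commute)
      have zs: "(w', x) \<in> ball ?z0 \<tau>" if "x \<in> cball v (\<tau> / 4)" for x
        using in_ball[of w' x] nw that by (simp add: dist_norm norm_minus_commute)
      have "\<exists>v'\<in>cball v (\<tau> / 4). F (w', v') = 0"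
      proof (rule approximately_linear_zero[OF AB b])
        show "norm (F (w', x) - F (w', x') - D_u ?z0 (x - x')) \<le> norm (x - x') / (2 * b)"
          if "x \<in> cball v (\<tau> / 4)" "x' \<in> cball v (\<tau> / 4)" for x x'
          using lin[OF zs[OF that(1)] zs[OF that(2)]] by simp
        have "norm (F (w', v) - F' ?z0 (w' - w, 0)) \<le> norm (w' - w) / (2 * b)"
          using lin[OF zs[of v] in_ball[of w v]] zero \<open>\<tau> > 0\<close> by simp
        moreover have "norm (F' ?z0 (w' - w, 0)) \<le> norm (F' ?z0) * norm (w' - w)"
          using norm_blinfun[of "F' ?z0" "(w' - w, 0)"] by simp
        ultimately have "norm (F (w', v)) \<le> norm (w' - w) / (2 * b) + norm (F' ?z0) * norm (w' - w)"
          using norm_triangle_sub[of "F (w', v)" "F' ?z0 (w' - w, 0)"] by linarith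
        also have "\<dots> = L * norm (w' - w) / (2 * b)"
          using b(2) by (simp add: L_def field_simps)
        also have "\<dots> \<le> (\<tau> / 4) / (2 * b)"
          using nw b by (intro divide_right_mono) auto
        finally show "norm (F (w', v)) \<le> \<tau> / 4 / (2 * b)" .
      qed (use \<open>\<tau> > 0\<close> in auto)
      then obtain v' where v': "v' \<in> cball v (\<tau> / 4)" "F (w', v') = 0" by blast
      then have "norm (v' - v) \<le> L * norm (w' - w)"
        using lip[OF zs[OF v'(1)] in_ball[of w v]] zero \<open>\<tau> > 0\<close> by simp
      with v' show ?thesis by blast
    qed
    have box: "(w', v') \<in> ball ?z0 \<tau>" if "w' \<in> ball w \<rho>" "v' \<in> ball v \<rho>" for w' v'
      using in_ball[of w' v'] that \<rho> by (simp add: dist_norm norm_minus_commute)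
    show ?thesis
      unfolding locally_solvable_def
      by (intro conjI ballI impI solution lip[OF box box] reg[OF box])
  qed
  moreover have "\<tau> / 2 > 0" "L \<ge> 0" using \<open>\<tau> > 0\<close> \<open>L \<ge> 1\<close> by auto
  ultimately show ?thesis using \<rho>(1) by blast
qed

section \<open>Lifting rays to the zero set\<close>

definition lifted_ray :: "'w \<Rightarrow> 'u \<Rightarrow> 'w \<Rightarrow> (real \<Rightarrow> 'u) \<Rightarrow> bool"
  where "lifted_ray w0 v0 w \<phi> \<longleftrightarrow> continuous_on {0..1} \<phi> \<and> \<phi> 0 = v0 \<and>
    (\<forall>t\<in>{0..1}. F (w0 + t *\<^sub>R (w - w0), \<phi> t) = 0 \<and> regular (w0 + t *\<^sub>R (w - w0), \<phi> t))"

text \<open>Two lifts agree on a closed set of times, and on an open one by local uniqueness; they agree at time 0.\<close>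

lemma lifted_ray_unique:
  assumes \<phi>: "lifted_ray w0 v0 w \<phi>" and \<psi>: "lifted_ray w0 v0 w \<psi>" and t: "t \<in> {0..1}"
  shows "\<phi> t = \<psi> t"
proof -
  let ?w = "\<lambda>t. w0 + t *\<^sub>R (w - w0)"
  let ?S = "{t \<in> {0..1}. \<phi> t - \<psi> t = 0}"
  have cont: "continuous_on {0..1} \<phi>" "continuous_on {0..1} \<psi>"
    using \<phi> \<psi> by (auto simp: lifted_ray_def)
  have "closedin (top_of_set {0..1}) ?S"
    by (intro continuous_closedin_preimage_constant continuous_intros cont)
  moreover have "openin (top_of_set {0..1}) ?S"
    unfolding openin_contains_ball
  proof (intro conjI ballI)
    fix t assume "t \<in> ?S"
    then have t: "t \<in> {0..1}" "\<psi> t = \<phi> t" by auto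
    then have z: "F (?w t, \<phi> t) = 0" "regular (?w t, \<phi> t)"
      using \<phi> by (auto simp: lifted_ray_def)
    then obtain \<rho> L where "\<rho> > 0" and solv: "locally_solvable \<rho> L (?w t) (\<phi> t)"
      using regular_zero_locally_solvable[OF z(2)] by (metis centre_in_ball)
    have "((\<lambda>s. ?w s) \<longlongrightarrow> ?w t) (at t within {0..1})" by (intro tendsto_intros)
    moreover have "(\<phi> \<longlongrightarrow> \<phi> t) (at t within {0..1})" "(\<psi> \<longlongrightarrow> \<psi> t) (at t within {0..1})"
      using cont t(1) by (simp_all only: continuous_on_def)
    ultimately have "\<forall>\<^sub>F s in at t within {0..1}.
        dist (?w s) (?w t) < \<rho> \<and> dist (\<phi> s) (\<phi> t) < \<rho> \<and> dist (\<psi> s) (\<psi> t) < \<rho>"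
      using \<open>\<rho> > 0\<close> by (intro eventually_conj tendstoD)
    then obtain d where "d > 0" and d: "\<And>s. s \<in> {0..1} \<Longrightarrow> s \<noteq> t \<Longrightarrow> dist s t < d \<Longrightarrow>
        dist (?w s) (?w t) < \<rho> \<and> dist (\<phi> s) (\<phi> t) < \<rho> \<and> dist (\<psi> s) (\<psi> t) < \<rho>"
      unfolding eventually_at by blast
    have "s \<in> ?S" if s: "s \<in> ball t d \<inter> {0..1}" for s
    proof (cases "s = t")
      case False
      then have near: "?w s \<in> ball (?w t) \<rho>" "\<phi> s \<in> ball (\<phi> t) \<rho>" "\<psi> s \<in> ball (\<phi> t) \<rho>"
        using d[of s] s t(2) by (auto simp: dist_commute)
      have "F (?w s, \<phi> s) = 0" "F (?w s, \<psi> s) = 0"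
        using \<phi> \<psi> s by (auto simp: lifted_ray_def)
      then have "norm (\<phi> s - \<psi> s) \<le> L * norm (?w s - ?w s)"
        using solv near unfolding locally_solvable_def by blast
      then show ?thesis using s by simp
    qed (use \<open>t \<in> ?S\<close> in simp)
    then show "\<exists>e>0. ball t e \<inter> {0..1} \<subseteq> ?S" using \<open>d > 0\<close> by blast
  qed auto
  moreover have "0 \<in> ?S" using \<phi> \<psi> by (auto simp: lifted_ray_def)
  ultimately have S: "?S = {0..1}"
    using connected_clopen[of "{0..1::real}"] connected_Icc[of 0 "1::real"] by blast
  have "t \<in> ?S" unfolding S by (fact t)
  then show ?thesis by simp
qed

text \<open>The graph of a lift is compact, so finitely many neighbourhoods of locally uniform solvability cover it.\<close>

lemma lifted_ray_uniformly_solvable: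
  assumes \<phi>: "lifted_ray w0 v0 w \<phi>"
  shows "\<exists>\<rho>>0. \<exists>L\<ge>0. \<forall>t\<in>{0..1}. locally_solvable \<rho> L (w0 + t *\<^sub>R (w - w0)) (\<phi> t)"
proof -
  let ?z = "\<lambda>t. (w0 + t *\<^sub>R (w - w0), \<phi> t)"
  have "\<exists>\<sigma> \<rho> L. \<sigma> > 0 \<and> \<rho> > 0 \<and> L \<ge> 0 \<and> (\<forall>w v. F (w, v) = 0 \<longrightarrow> (w, v) \<in> ball (?z t) \<sigma> \<longrightarrow>
      locally_solvable \<rho> L w v)" if "t \<in> {0..1}" for t
    using regular_zero_locally_solvable \<phi> that unfolding lifted_ray_def by metis
  then obtain \<sigma> \<rho> L where loc: "\<And>t. t \<in> {0..1} \<Longrightarrow> \<sigma> t > 0 \<and> \<rho> t > 0 \<and> L t \<ge> 0 \<and>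
      (\<forall>w v. F (w, v) = 0 \<longrightarrow> (w, v) \<in> ball (?z t) (\<sigma> t) \<longrightarrow> locally_solvable (\<rho> t) (L t) w v)"
    by metis
  have "compact (?z ` {0..1})"
    using \<phi> by (intro compact_continuous_image continuous_intros) (auto simp: lifted_ray_def)
  moreover have "\<And>t. t \<in> {0..1} \<Longrightarrow> open (ball (?z t) (\<sigma> t))" by simp
  moreover have "?z ` {0..1} \<subseteq> (\<Union>t\<in>{0..1}. ball (?z t) (\<sigma> t))"
    using loc by force
  ultimately obtain T where T: "T \<subseteq> {0..1}" "finite T" "?z ` {0..1} \<subseteq> (\<Union>t\<in>T. ball (?z t) (\<sigma> t))"
    by (rule compactE_image)
  have "T \<noteq> {}" using T(3) by force
  have "locally_solvable (Min (\<rho> ` T)) (sum L T) (w0 + t *\<^sub>R (w - w0)) (\<phi> t)" if t: "t \<in> {0..1}" for t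
  proof -
    obtain s where s: "s \<in> T" "?z t \<in> ball (?z s) (\<sigma> s)" using T(3) t by blast
    have "F (?z t) = 0" using \<phi> t by (simp add: lifted_ray_def)
    then have "locally_solvable (\<rho> s) (L s) (w0 + t *\<^sub>R (w - w0)) (\<phi> t)"
      using loc[of s] s T(1) by blast
    moreover have "Min (\<rho> ` T) \<le> \<rho> s" using T(2) s by simp
    moreover have "L s \<le> sum L T"
      using T(1,2) s loc by (intro member_le_sum) auto
    ultimately show ?thesis by (rule locally_solvable_mono)
  qed
  moreover have "Min (\<rho> ` T) > 0" using T(1,2) loc \<open>T \<noteq> {}\<close> by (auto simp: subset_iff)
  moreover have "sum L T \<ge> 0" using T(1) loc by (intro sum_nonneg) auto
  ultimately show ?thesis by blast
qed

text \<open>For \<open>w'\<close> close to \<open>w\<close>, local solvability at each time gives a zero over the nearby ray, close to the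
  given lift. These zeros are chosen independently of each other; the Lipschitz clause of
  local solvability shows that they nevertheless form a continuous path.\<close>

lemma lifted_ray_perturb:
  assumes \<phi>: "lifted_ray w0 v0 w \<phi>"
  shows "\<exists>\<eta>>0. \<exists>L\<ge>0. \<forall>w'\<in>ball w \<eta>. \<exists>\<psi>. lifted_ray w0 v0 w' \<psi> \<and>
    norm (\<psi> 1 - \<phi> 1) \<le> L * norm (w' - w)"
proof -
  let ?r = "\<lambda>w t. w0 + t *\<^sub>R (w - w0)"
  obtain \<rho> L where "\<rho> > 0" "L \<ge> 0"
    and solv: "\<And>t. t \<in> {0..1} \<Longrightarrow> locally_solvable \<rho> L (?r w t) (\<phi> t)"
    using lifted_ray_uniformly_solvable[OF \<phi>] by blast
  \<comment> \<open>Displacements below \<open>\<rho> / 2\<close> leave room for comparing the zeros at two nearby times.\<close>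
  define \<eta> where "\<eta> = \<rho> / (2 * (L + 1))"
  have \<eta>: "\<eta> > 0" "\<eta> \<le> \<rho> / 2" "L * \<eta> < \<rho> / 2"
    using \<open>\<rho> > 0\<close> \<open>L \<ge> 0\<close> by (auto simp: \<eta>_def field_simps)
  have "\<exists>\<psi>. lifted_ray w0 v0 w' \<psi> \<and> norm (\<psi> 1 - \<phi> 1) \<le> L * norm (w' - w)"
    if w': "w' \<in> ball w \<eta>" for w'
  proof -
    have nw: "norm (w' - w) < \<eta>" using w' by (simp add: dist_norm norm_minus_commute)
    have ray_diff: "norm (?r w' t - ?r w t) \<le> norm (w' - w)" if "t \<in> {0..1}" for t
    proof -
      have "?r w' t - ?r w t = t *\<^sub>R (w' - w)" by (simp add: algebra_simps)
      then show ?thesis using that by (simp add: mult_left_le_one_le)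
    qed
    have ray_near: "?r w' t \<in> ball (?r w t) (\<rho> / 2)" if "t \<in> {0..1}" for t
      using ray_diff[OF that] nw \<eta> by (simp add: dist_norm norm_minus_commute)
    have "\<exists>v. F (?r w' t, v) = 0 \<and> norm (v - \<phi> t) \<le> L * norm (?r w' t - ?r w t)"
      if "t \<in> {0..1}" for t
    proof -
      have "?r w' t \<in> ball (?r w t) \<rho>" using ray_near[OF that] \<open>\<rho> > 0\<close> by auto
      then show ?thesis using solv[OF that] unfolding locally_solvable_def by blast
    qed
    then obtain \<psi> where \<psi>: "\<And>t. t \<in> {0..1} \<Longrightarrow> F (?r w' t, \<psi> t) = 0 \<and>
        norm (\<psi> t - \<phi> t) \<le> L * norm (?r w' t - ?r w t)"
      by metis
    have close: "norm (\<psi> t - \<phi> t) \<le> L * norm (w' - w)" if "t \<in> {0..1}" for t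
      using \<psi>[OF that] mult_left_mono[OF ray_diff[OF that] \<open>L \<ge> 0\<close>] by linarith
    then have close': "norm (\<psi> t - \<phi> t) < \<rho> / 2" if "t \<in> {0..1}" for t
      using \<eta>(3) nw \<open>L \<ge> 0\<close> that mult_left_mono[of "norm (w' - w)" \<eta> L] by fastforce
    have "regular (?r w' t, \<psi> t)" if "t \<in> {0..1}" for t
    proof -
      have "?r w' t \<in> ball (?r w t) \<rho>" "\<psi> t \<in> ball (\<phi> t) \<rho>"
        using ray_near[OF that] close'[OF that] \<open>\<rho> > 0\<close> by (auto simp: dist_norm norm_minus_commute)
      then show ?thesis using solv[OF that] unfolding locally_solvable_def by blast
    qed
    moreover have "\<psi> 0 = v0"
      using \<psi>[of 0] \<phi> by (simp add: lifted_ray_def)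
    moreover have "continuous_on {0..1} \<psi>"
      unfolding continuous_on_def
    proof
      fix t :: real assume t: "t \<in> {0..1}"
      have "(\<phi> \<longlongrightarrow> \<phi> t) (at t within {0..1})"
        using \<phi> t by (auto simp: lifted_ray_def continuous_on_def)
      moreover have "((\<lambda>s. ?r w' s) \<longlongrightarrow> ?r w' t) (at t within {0..1})" by (intro tendsto_intros)
      ultimately have "\<forall>\<^sub>F s in at t within {0..1}. s \<in> {0..1} \<and>
          dist (\<phi> s) (\<phi> t) < \<rho> / 2 \<and> dist (?r w' s) (?r w' t) < \<rho> / 2"
        using \<open>\<rho> > 0\<close> by (intro eventually_conj tendstoD eventually_at_topological[THEN iffD2]) auto
      then have "\<forall>\<^sub>F s in at t within {0..1}. norm (\<psi> s - \<psi> t) \<le> L * norm (?r w' s - ?r w' t)"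
      proof eventually_elim
        case (elim s)
        then have s: "s \<in> {0..1}" by blast
        have "dist (?r w t) (?r w' s) \<le> dist (?r w t) (?r w' t) + dist (?r w' t) (?r w' s)"
          by (rule dist_triangle)
        then have 1: "?r w' s \<in> ball (?r w t) \<rho>"
          using elim ray_near[OF t] by (simp add: dist_commute)
        have "dist (\<phi> t) (\<psi> s) \<le> dist (\<phi> t) (\<phi> s) + dist (\<phi> s) (\<psi> s)"
          by (rule dist_triangle)
        moreover have "dist (\<phi> s) (\<psi> s) < \<rho> / 2"
          using close'[OF s] by (simp add: dist_norm norm_minus_commute)
        ultimately have 2: "\<psi> s \<in> ball (\<phi> t) \<rho>"
          using elim by (simp add: dist_commute)
        have 3: "?r w' t \<in> ball (?r w t) \<rho>" "\<psi> t \<in> ball (\<phi> t) \<rho>"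
          using ray_near[OF t] close'[OF t] \<open>\<rho> > 0\<close> by (auto simp: dist_norm norm_minus_commute)
        show ?case
          using solv[OF t] 1 2 3 \<psi>[OF s] \<psi>[OF t] unfolding locally_solvable_def by blast
      qed
      moreover have "((\<lambda>s. L * norm (?r w' s - ?r w' t)) \<longlongrightarrow> 0) (at t within {0..1})"
        by (rule tendsto_eq_intros refl | simp)+
      ultimately have "((\<lambda>s. \<psi> s - \<psi> t) \<longlongrightarrow> 0) (at t within {0..1})"
        by (rule Lim_null_comparison)
      then show "(\<psi> \<longlongrightarrow> \<psi> t) (at t within {0..1})" by (simp add: LIM_zero_iff)
    qed
    ultimately have "lifted_ray w0 v0 w' \<psi>" using \<psi> by (simp add: lifted_ray_def)
    then show ?thesis using close[of 1] by auto
  qed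
  then show ?thesis using \<eta>(1) \<open>L \<ge> 0\<close> by blast
qed

definition ray_domain :: "'w \<Rightarrow> 'u \<Rightarrow> 'w set"
  where "ray_domain w0 v0 = {w. \<exists>\<phi>. lifted_ray w0 v0 w \<phi>}"

definition continuation :: "'w \<Rightarrow> 'u \<Rightarrow> 'w \<Rightarrow> 'u"
  where "continuation w0 v0 w = (SOME \<phi>. lifted_ray w0 v0 w \<phi>) 1"

lemma continuation_eq:
  assumes "lifted_ray w0 v0 w \<phi>"
  shows "continuation w0 v0 w = \<phi> 1"
  unfolding continuation_def
  using lifted_ray_unique[OF someI[of "lifted_ray w0 v0 w", OF assms] assms] by simp

lemma ray_domain_zero:
  assumes "w \<in> ray_domain w0 v0"
  shows "F (w, continuation w0 v0 w) = 0" "regular (w, continuation w0 v0 w)"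
proof -
  obtain \<phi> where \<phi>: "lifted_ray w0 v0 w \<phi>" using assms by (auto simp: ray_domain_def)
  then show "F (w, continuation w0 v0 w) = 0" "regular (w, continuation w0 v0 w)"
    unfolding continuation_eq[OF \<phi>] by (auto simp: lifted_ray_def dest!: bspec[of _ _ 1])
qed

lemma lifted_ray_initial_part:
  assumes \<phi>: "lifted_ray w0 v0 w \<phi>" and s: "s \<in> {0..1}"
  shows "lifted_ray w0 v0 (w0 + s *\<^sub>R (w - w0)) (\<lambda>t. \<phi> (t * s))"
proof -
  have ts: "t * s \<in> {0..1}" if "t \<in> {0..1}" for t
    using that s by (auto intro: mult_le_one)
  have "continuous_on {0..1} (\<lambda>t. \<phi> (t * s))"
  proof (rule continuous_on_compose2[of "{0..1}" \<phi> "{0..1}" "\<lambda>t. t * s"])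
    show "continuous_on {0..1} \<phi>" using \<phi> by (simp add: lifted_ray_def)
    show "(\<lambda>t. t * s) ` {0..1} \<subseteq> {0..1}" using ts by blast
  qed (intro continuous_intros)
  then show ?thesis using \<phi> ts unfolding lifted_ray_def by simp
qed

lemma continuation_along_ray:
  assumes "lifted_ray w0 v0 w \<phi>" "s \<in> {0..1}"
  shows "w0 + s *\<^sub>R (w - w0) \<in> ray_domain w0 v0"
    and "continuation w0 v0 (w0 + s *\<^sub>R (w - w0)) = \<phi> s"
  using lifted_ray_initial_part[OF assms] continuation_eq[OF lifted_ray_initial_part[OF assms]]
  by (auto simp: ray_domain_def)

lemma ray_domain_star:
  assumes "w \<in> ray_domain w0 v0" "s \<in> {0..1}"
  shows "w0 + s *\<^sub>R (w - w0) \<in> ray_domain w0 v0"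
  using assms continuation_along_ray(1) unfolding ray_domain_def by blast

lemma continuation_lipschitz_near:
  assumes "w \<in> ray_domain w0 v0"
  shows "\<exists>\<eta>>0. \<exists>L\<ge>0. \<forall>w'\<in>ball w \<eta>. w' \<in> ray_domain w0 v0 \<and>
    norm (continuation w0 v0 w' - continuation w0 v0 w) \<le> L * norm (w' - w)"
proof -
  obtain \<phi> where \<phi>: "lifted_ray w0 v0 w \<phi>" using assms by (auto simp: ray_domain_def)
  obtain \<eta> L where \<eta>: "\<eta> > 0" "L \<ge> 0" "\<And>w'. w' \<in> ball w \<eta> \<Longrightarrow> \<exists>\<psi>. lifted_ray w0 v0 w' \<psi> \<and>
      norm (\<psi> 1 - \<phi> 1) \<le> L * norm (w' - w)"
    using lifted_ray_perturb[OF \<phi>] by blast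
  have "w' \<in> ray_domain w0 v0 \<and>
      norm (continuation w0 v0 w' - continuation w0 v0 w) \<le> L * norm (w' - w)"
    if "w' \<in> ball w \<eta>" for w'
    using \<eta>(3)[OF that] \<phi> continuation_eq by (auto simp: ray_domain_def)
  then show ?thesis using \<eta>(1,2) by blast
qed

lemma open_ray_domain: "open (ray_domain w0 v0)"
  unfolding open_contains_ball using continuation_lipschitz_near by blast

text \<open>Implicit differentiation: a solution that is Lipschitz at a point turns the first-order expansion
  of \<open>F\<close> into one of the solution, after applying \<open>B\<close>.\<close>

lemma implicit_solution_has_derivative:
  assumes B: "blinfun_inverse (D_u (w, V w)) B"
    and lip: "\<forall>\<^sub>F w' in at w. norm (V w' - V w) \<le> L * norm (w' - w)"
    and zero: "\<forall>\<^sub>F w' in at w. F (w', V w') = 0" "F (w, V w) = 0"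
  shows "(V has_derivative (\<lambda>h. - B (F' (w, V w) (h, 0)))) (at w)"
proof -
  \<comment> \<open>A negative \<open>L\<close> is not excluded, and the estimates below divide by \<open>L' + 1\<close>.\<close>
  define L' where "L' = max L 0"
  have lim: "\<forall>\<^sub>F w' in at w. norm (V w' - V w + B (F' (w, V w) (w' - w, 0))) \<le> e * norm (w' - w)"
    if "e > 0" for e
  proof -
    \<comment> \<open>The remainder of \<open>F\<close> is multiplied by \<open>B\<close>, and it is measured by the pair of increments, which is at most \<open>L' + 1\<close> times the first one.\<close>
    define c where "c = e / ((norm B + 1) * (L' + 1))"
    have den: "(norm B + 1) * (L' + 1) > 0"
      by (intro mult_pos_pos add_nonneg_pos) (auto simp: L'_def)
    then have "c > 0" using that by (simp add: c_def)
    obtain d where d: "d > 0" "\<And>z. norm (z - (w, V w)) < d \<Longrightarrow>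
        norm (F z - F (w, V w) - F' (w, V w) (z - (w, V w))) \<le> c * norm (z - (w, V w))"
      using has_derivative_F[of "(w, V w)"] \<open>c > 0\<close> unfolding has_derivative_at_alt by blast
    have "\<forall>\<^sub>F w' in at w. norm (w' - w) < d / (L' + 1)"
      using d(1) eventually_at[of "\<lambda>w'. norm (w' - w) < d / (L' + 1)" w UNIV]
      by (auto simp: L'_def dist_norm intro!: exI[of _ "d / (L' + 1)"])
    with lip zero(1) show ?thesis
    proof eventually_elim
      case (elim w')
      have Lmul: "norm (V w' - V w) \<le> L' * norm (w' - w)"
        using elim(1) mult_right_mono[of L L' "norm (w' - w)"] by (simp add: L'_def)
      have pair: "norm ((w', V w') - (w, V w)) \<le> (L' + 1) * norm (w' - w)"
        using norm_Pair_diff_le[of w' "V w'" w "V w"] Lmul by (simp add: algebra_simps)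
      also have "\<dots> < d"
        using elim(3) by (simp add: L'_def pos_less_divide_eq mult.commute)
      finally have small: "norm (F' (w, V w) (w' - w, V w' - V w)) \<le> c * norm ((w', V w') - (w, V w))"
        using d(2)[of "(w', V w')"] elim(2) zero(2) by simp
      have "(w' - w, V w' - V w) = (0, V w' - V w) + (w' - w, 0)" by simp
      then have "F' (w, V w) (w' - w, V w' - V w) = F' (w, V w) (0, V w' - V w) + F' (w, V w) (w' - w, 0)"
        by (metis blinfun.add_right)
      moreover have "B (F' (w, V w) (0, V w' - V w)) = V w' - V w"
        using B by (metis D_u_apply blinfun_inverse_def)
      ultimately have "V w' - V w + B (F' (w, V w) (w' - w, 0)) =
          B (F' (w, V w) (w' - w, V w' - V w))"
        by (simp add: blinfun.add_right)
      then have "norm (V w' - V w + B (F' (w, V w) (w' - w, 0))) \<le>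
          norm B * norm (F' (w, V w) (w' - w, V w' - V w))"
        using norm_blinfun by metis
      also have "\<dots> \<le> (norm B + 1) * (c * ((L' + 1) * norm (w' - w)))"
        using small pair \<open>c > 0\<close>
        by (intro mult_mono order_trans[OF small] mult_left_mono[OF pair]) auto
      also have "\<dots> = ((norm B + 1) * (L' + 1)) * c * norm (w' - w)" by (simp add: algebra_simps)
      also have "\<dots> = e * norm (w' - w)"
        using den unfolding c_def by (metis less_irrefl nonzero_mult_div_cancel_left times_divide_eq_right)
      finally show ?case .
    qed
  qed
  have "bounded_linear (\<lambda>h. - B (F' (w, V w) (h, 0)))"
    by (intro bounded_linear_minus bounded_linear_compose[OF blinfun.bounded_linear_right]
        bounded_linear_Pair bounded_linear_ident bounded_linear_zero)
  moreover have "\<exists>d>0. \<forall>w'. norm (w' - w) < d \<longrightarrow>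
      norm (V w' - V w - - B (F' (w, V w) (w' - w, 0))) \<le> e * norm (w' - w)" if pos: "e > 0" for e
  proof -
    obtain d where "d > 0" and d: "\<And>w'. w' \<noteq> w \<Longrightarrow> norm (w' - w) < d \<Longrightarrow>
        norm (V w' - V w + B (F' (w, V w) (w' - w, 0))) \<le> e * norm (w' - w)"
      using lim[OF pos] unfolding eventually_at dist_norm by blast
    have "norm (V w' - V w - - B (F' (w, V w) (w' - w, 0))) \<le> e * norm (w' - w)"
      if "norm (w' - w) < d" for w'
    proof (cases "w' = w")
      case True
      then show ?thesis by (simp flip: zero_prod_def)
    next
      case False
      then show ?thesis using d[OF False that] by simp
    qed
    then show ?thesis using \<open>d > 0\<close> by blast
  qed
  ultimately show ?thesis unfolding has_derivative_at_alt by blast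
qed

lemma continuation_has_derivative:
  assumes w: "w \<in> ray_domain w0 v0" and B: "blinfun_inverse (D_u (w, continuation w0 v0 w)) B"
  shows "(continuation w0 v0 has_derivative (\<lambda>h. - B (F' (w, continuation w0 v0 w) (h, 0)))) (at w)"
proof -
  obtain \<eta> L where \<eta>: "\<eta> > 0" "\<And>w'. w' \<in> ball w \<eta> \<Longrightarrow> w' \<in> ray_domain w0 v0 \<and>
      norm (continuation w0 v0 w' - continuation w0 v0 w) \<le> L * norm (w' - w)"
    using continuation_lipschitz_near[OF w] by blast
  have "\<forall>\<^sub>F w' in at w. w' \<in> ball w \<eta>"
    using \<eta>(1) by (intro eventually_at_in_open') auto
  then show ?thesis
    using \<eta>(2) ray_domain_zero(1) w
    by (intro implicit_solution_has_derivative[where L = L and V = "continuation w0 v0", OF B]) (auto elim!: eventually_mono)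
qed

section \<open>Continuation to a whole ball\<close>

text \<open>A Lipschitz bound extends the continuation to the end of the half-open segment, and zeros pass to
  the limit. Regularity is an open condition and would be lost in general; the bound on the inverses saves it,
  since the inverse at a point close to the end has a perturbation radius independent of that point.\<close>

lemma limit_of_regular_rays:
  assumes w: "\<And>s. s \<in> {0..<1} \<Longrightarrow> w0 + s *\<^sub>R (w - w0) \<in> ray_domain w0 v0"
    and lip: "C-lipschitz_on {0..<1} (\<lambda>s. continuation w0 v0 (w0 + s *\<^sub>R (w - w0)))"
    and bound: "\<And>s. s \<in> {0..<1} \<Longrightarrow> \<exists>B. norm B \<le> b \<and>
      blinfun_inverse (D_u (w0 + s *\<^sub>R (w - w0), continuation w0 v0 (w0 + s *\<^sub>R (w - w0)))) B"
  shows "w \<in> ray_domain w0 v0"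
proof -
  let ?r = "\<lambda>s. w0 + s *\<^sub>R (w - w0)"
  let ?f = "\<lambda>s. continuation w0 v0 (?r s)"
  have cl: "closure {0..<1::real} = {0..1}" by simp
  obtain \<phi> where lip_\<phi>: "C-lipschitz_on {0..1} \<phi>" and \<phi>: "\<And>s. s \<in> {0..<1} \<Longrightarrow> \<phi> s = ?f s"
    using lipschitz_extend_closure[OF lip] unfolding cl by metis
  have cont: "continuous_on {0..1} \<phi>" using lip_\<phi> by (rule lipschitz_on_continuous_on)
  have cont_z: "continuous_on {0..1} (\<lambda>s. (?r s, \<phi> s))" by (intro continuous_intros cont)
  have zero: "F (?r s, \<phi> s) = 0" if "s \<in> {0..1}" for s
  proof -
    have "continuous_on (closure {0..<1}) (\<lambda>s. F (?r s, \<phi> s))"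
      unfolding cl using continuous_on_compose2[OF continuous_F cont_z] by simp
    moreover have "F (?r s, \<phi> s) = 0" if "s \<in> {0..<1}" for s
      using ray_domain_zero(1)[OF w[OF that]] \<phi>[OF that] by simp
    ultimately show ?thesis
      using continuous_constant_on_closure that cl by blast
  qed
  have reg: "regular (?r s, \<phi> s)" if "s \<in> {0..<1}" for s
    using ray_domain_zero(2)[OF w[OF that]] \<phi>[OF that] by simp
  have reg1: "regular (?r 1, \<phi> 1)"
  proof -
    define c where "c = max b 1"
    have c: "c > 0" "b \<le> c" by (auto simp: c_def)
    obtain d where d: "d > 0" "\<And>z. z \<in> ball (?r 1, \<phi> 1) d \<Longrightarrow> norm (F' z - F' (?r 1, \<phi> 1)) \<le> 1 / (2 * c)"
      using F'_close[of "1 / (2 * c)" "(?r 1, \<phi> 1)"] c by auto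
    obtain e where e: "e > 0" "\<And>s. s \<in> {0..1} \<Longrightarrow> dist s 1 < e \<Longrightarrow> dist (?r s, \<phi> s) (?r 1, \<phi> 1) < d"
      using cont_z d(1) unfolding continuous_on_iff by (meson atLeastAtMost_iff order_refl zero_le_one)
    define s where "s = max (1 - e / 2) 0"
    have s: "s \<in> {0..<1}" "dist s 1 < e" using e(1) by (auto simp: s_def dist_real_def)
    obtain B where B: "norm B \<le> b" "blinfun_inverse (D_u (?r s, \<phi> s)) B"
      using bound[OF s(1)] \<phi>[OF s(1)] by metis
    have "(?r s, \<phi> s) \<in> ball (?r 1, \<phi> 1) d" using e(2)[of s] s by (simp add: dist_commute)
    then have "norm (D_u (?r 1, \<phi> 1) - D_u (?r s, \<phi> s)) \<le> 1 / (2 * c)"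
      by (subst norm_minus_commute) (rule order_trans[OF norm_D_u_diff d(2)])
    then show ?thesis
      using blinfun_inverse_perturbation[OF B(2) order_trans[OF B(1) c(2)] c(1)]
      unfolding regular_def by blast
  qed
  have reg': "regular (?r s, \<phi> s)" if "s \<in> {0..1}" for s
  proof (cases "s = 1")
    case True
    then show ?thesis using reg1 by simp
  next
    case False
    then show ?thesis using reg[of s] that by simp
  qed
  obtain \<psi> where \<psi>: "lifted_ray w0 v0 (?r 0) \<psi>" using w[of 0] by (auto simp: ray_domain_def)
  have "\<phi> 0 = v0"
    using \<phi>[of 0] continuation_eq[OF \<psi>] continuation_along_ray(2)[OF \<psi>, of 0] \<psi>
    by (simp add: lifted_ray_def)
  then have "lifted_ray w0 v0 w \<phi>"
    unfolding lifted_ray_def using cont zero reg' by blast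
  then show ?thesis unfolding ray_domain_def by blast
qed

text \<open>On each ray the times at which the point lies in \<open>ray_domain\<close> form an interval that is open, since
  \<open>ray_domain\<close> is, and closed by the preceding lemma.\<close>

lemma ball_subset_ray_domain:
  assumes start: "F (w0, v0) = 0" "regular (w0, v0)"
    and bound: "\<And>w. w \<in> ball w0 \<epsilon> \<inter> ray_domain w0 v0 \<Longrightarrow>
      \<exists>B. norm B \<le> b \<and> blinfun_inverse (D_u (w, continuation w0 v0 w)) B"
    and deriv: "\<And>w. w \<in> ball w0 \<epsilon> \<inter> ray_domain w0 v0 \<Longrightarrow>
      onorm (frechet_derivative (continuation w0 v0) (at w)) \<le> M"
  shows "ball w0 \<epsilon> \<subseteq> ray_domain w0 v0"
proof
  fix w assume w: "w \<in> ball w0 \<epsilon>"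
  let ?r = "\<lambda>s. w0 + s *\<^sub>R (w - w0)"
  have r_ball: "?r s \<in> ball w0 \<epsilon>" if "s \<in> {0..1}" for s
  proof -
    have "norm (s *\<^sub>R (w - w0)) \<le> norm (w - w0)"
      using that by (simp add: mult_left_le_one_le)
    then show ?thesis using w by (simp add: dist_norm norm_minus_commute)
  qed
  define T where "T = {s \<in> {0..1}. ?r s \<in> ray_domain w0 v0}"
  have "lifted_ray w0 v0 w0 (\<lambda>_. v0)" using start by (simp add: lifted_ray_def)
  then have "0 \<in> T" by (auto simp: T_def ray_domain_def)
  have r_r: "w0 + t *\<^sub>R (?r s - w0) = ?r (t * s)" for s t by simp
  have down: "t \<in> T" if "s \<in> T" "0 \<le> t" "t \<le> s" for s t
  proof (cases "s = 0")
    case False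
    then have "t / s \<in> {0..1}" "t / s * s = t" using that by (auto simp: T_def)
    then show ?thesis
      using ray_domain_star[of "?r s" w0 v0 "t / s"] that unfolding r_r by (auto simp: T_def)
  qed (use that in simp)
  define m where "m = Sup T"
  have T_bdd: "bdd_above T" unfolding T_def by (rule bdd_aboveI[of _ 1]) auto
  have "0 \<le> m" unfolding m_def by (rule cSup_upper[OF \<open>0 \<in> T\<close> T_bdd])
  moreover have "m \<le> 1"
    unfolding m_def
  proof (rule cSup_least)
    show "T \<noteq> {}" using \<open>0 \<in> T\<close> by blast
  qed (simp add: T_def)
  ultimately have m: "m \<in> {0..1}" by simp
  have below: "t \<in> T" if t: "0 \<le> t" "t < m" for t
  proof -
    obtain s where "s \<in> T" "t < s"
      using t(2) less_cSupD[of T t] \<open>0 \<in> T\<close> unfolding m_def by blast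
    then show ?thesis using down t(1) by simp
  qed
  have "m \<in> T"
  proof -
    have sm: "0 \<le> s * m" "s * m \<le> m" "s * m \<le> 1" "s * m \<in> T" if "s \<in> {0..<1}" for s
    proof -
      show 1: "0 \<le> s * m" "s * m \<le> m" using m that by (auto intro: mult_left_le_one_le)
      show "s * m \<le> 1" using 1 m by simp
      show "s * m \<in> T"
      proof (cases "m = 0")
        case False
        then show ?thesis using 1 m that by (intro below) auto
      qed (use \<open>0 \<in> T\<close> in simp)
    qed
    have dom: "?r (s * m) \<in> ball w0 \<epsilon> \<inter> ray_domain w0 v0" if "s \<in> {0..<1}" for s
      using sm[OF that] r_ball[of "s * m"] by (auto simp: T_def)
    let ?V = "continuation w0 v0"
    let ?D = "\<lambda>s. frechet_derivative ?V (at (?r (s * m)))"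
    have der: "((\<lambda>s. ?V (?r (s * m))) has_derivative (\<lambda>h. ?D s ((h * m) *\<^sub>R (w - w0)))) (at s within {0..<1})"
      and on: "onorm (\<lambda>h. ?D s ((h * m) *\<^sub>R (w - w0))) \<le> M * norm (w - w0)"
      if s: "s \<in> {0..<1}" for s
    proof -
      obtain B where "blinfun_inverse (D_u (?r (s * m), ?V (?r (s * m)))) B"
        using bound[OF dom[OF s]] by blast
      then have D: "(?V has_derivative ?D s) (at (?r (s * m)))"
        using continuation_has_derivative dom[OF s] frechet_derivative_works
        unfolding differentiable_def by blast
      have R: "((\<lambda>s. ?r (s * m)) has_derivative (\<lambda>h. (h * m) *\<^sub>R (w - w0))) (at s within {0..<1})"
        by (auto intro!: derivative_eq_intros)
      show "((\<lambda>s. ?V (?r (s * m))) has_derivative (\<lambda>h. ?D s ((h * m) *\<^sub>R (w - w0)))) (at s within {0..<1})"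
        using has_derivative_compose[OF R D] .
      show "onorm (\<lambda>h. ?D s ((h * m) *\<^sub>R (w - w0))) \<le> M * norm (w - w0)"
      proof (rule onorm_le)
        fix h :: real
        have "norm (?D s ((h * m) *\<^sub>R (w - w0))) \<le> onorm (?D s) * norm ((h * m) *\<^sub>R (w - w0))"
          by (rule onorm[OF has_derivative_bounded_linear[OF D]])
        also have "\<dots> \<le> M * (\<bar>h\<bar> * norm (w - w0))"
        proof (rule mult_mono)
          show "onorm (?D s) \<le> M" by (rule deriv[OF dom[OF s]])
          then show "0 \<le> M"
            using onorm_pos_le[OF has_derivative_bounded_linear[OF D]] by linarith
          have "\<bar>h * m\<bar> \<le> \<bar>h\<bar>" using m by (simp add: abs_mult mult_left_le)
          then show "norm ((h * m) *\<^sub>R (w - w0)) \<le> \<bar>h\<bar> * norm (w - w0)"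
            by (simp only: norm_scaleR mult_right_mono norm_ge_zero)
        qed simp
        finally show "norm (?D s ((h * m) *\<^sub>R (w - w0))) \<le> M * norm (w - w0) * norm h"
          by (simp add: mult_ac)
      qed
    qed
    have "0 \<le> M * norm (w - w0)"
    proof -
      have "bounded_linear (\<lambda>h. ?D 0 ((h * m) *\<^sub>R (w - w0)))"
        by (rule has_derivative_bounded_linear[OF der]) simp
      then show ?thesis using onorm_pos_le on[of 0] by fastforce
    qed
    moreover have "norm (?V (?r (s * m)) - ?V (?r (t * m))) \<le> M * norm (w - w0) * norm (s - t)"
      if "s \<in> {0..<1}" "t \<in> {0..<1}" for s t
      by (rule differentiable_bound[OF _ der on that]) simp_all
    ultimately have "(M * norm (w - w0))-lipschitz_on {0..<1} (\<lambda>s. ?V (?r (s * m)))"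
      by (intro lipschitz_onI) (simp_all only: dist_norm)
    then have "?r m \<in> ray_domain w0 v0"
      using dom bound by (intro limit_of_regular_rays[of w0 "?r m" v0 "M * norm (w - w0)" b]) (simp_all only: r_r, auto)
    then show ?thesis using m by (simp add: T_def)
  qed
  have "m = 1"
  proof (rule ccontr)
    assume "m \<noteq> 1"
    then have "m < 1" using m by simp
    have "open ((\<lambda>s. ?r s) -` ray_domain w0 v0)"
      by (intro open_vimage open_ray_domain continuous_intros)
    moreover have "m \<in> (\<lambda>s. ?r s) -` ray_domain w0 v0" using \<open>m \<in> T\<close> by (simp add: T_def)
    ultimately obtain d where d: "d > 0" "ball m d \<subseteq> (\<lambda>s. ?r s) -` ray_domain w0 v0"
      unfolding open_contains_ball by blast
    define s where "s = min 1 (m + d / 2)"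
    have s: "m < s" "s \<le> 1" "s \<in> ball m d" using d(1) \<open>m < 1\<close> by (auto simp: s_def dist_real_def)
    then have "s \<in> T" using d(2) m by (auto simp: T_def)
    then show False using cSup_upper[OF _ T_bdd, of s] s(1) by (simp add: m_def)
  qed
  then show "w \<in> ray_domain w0 v0" using \<open>m \<in> T\<close> by (simp add: T_def)
qed

end

section \<open>Growth along a ray\<close>

locale growth_bound =
  fixes g :: "real \<Rightarrow> real" and \<xi> :: real
  assumes cont: "continuous_on {0..} g" and mono: "mono_on {0..} g"
    and pos: "0 \<le> s \<Longrightarrow> 0 < g s" and \<xi>_pos: "0 < \<xi>"
begin

lemma G_int_within:
  assumes "l \<in> {\<xi>..b}"
  shows "(G_int g \<xi> has_real_derivative 1 / g l) (at l within {\<xi>..b})"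
proof -
  have "g s \<noteq> 0" if "s \<in> {\<xi>..b}" for s
    using pos[of s] that \<xi>_pos by auto
  moreover have "continuous_on {\<xi>..b} g"
    by (rule continuous_on_subset[OF cont]) (use \<xi>_pos in auto)
  ultimately have "continuous_on {\<xi>..b} (\<lambda>s. 1 / g s)"
    by (intro continuous_intros) auto
  from integral_has_real_derivative[OF this assms] show ?thesis
    by (simp add: G_int_def[abs_def])
qed

lemma G_int_deriv:
  assumes "\<xi> < l"
  shows "(G_int g \<xi> has_real_derivative 1 / g l) (at l)"
  using G_int_within[of l "l + 1"] assms by (simp add: at_within_Icc_at)

lemma continuous_on_G_int: "continuous_on {\<xi>..b} (G_int g \<xi>)"
  by (intro DERIV_continuous_on[of _ _ "\<lambda>l. 1 / g l"] G_int_within)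

lemma G_int_strict_mono:
  assumes "\<xi> \<le> a" "a < b"
  shows "G_int g \<xi> a < G_int g \<xi> b"
proof (rule DERIV_pos_imp_increasing_open[OF assms(2)])
  fix x assume "a < x"
  then show "\<exists>y. (G_int g \<xi> has_real_derivative y) (at x) \<and> 0 < y"
    using G_int_deriv[of x] pos[of x] \<xi>_pos assms(1) by (intro exI[of _ "1 / g x"]) auto
next
  show "continuous_on {a..b} (G_int g \<xi>)"
    by (rule continuous_on_subset[OF continuous_on_G_int[of b]]) (use assms in auto)
qed

lemma G_int_mono:
  assumes "\<xi> \<le> a" "a \<le> b"
  shows "G_int g \<xi> a \<le> G_int g \<xi> b"
  using G_int_strict_mono[of a b] assms by (cases "a = b") auto

text \<open>A comparison argument for the differential inequality \<open>r' \<le> k * g (C + r)\<close> of \<open>r t = norm (f t - f 0)\<close>.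
  The norm need not be differentiable, so \<open>r\<close> is replaced by the integral \<open>p\<close> of the right-hand side, which
  dominates \<open>r\<close>. As \<open>g\<close> is increasing, \<open>p\<close> satisfies the same inequality,
  and \<open>G_int g \<xi> (C + p t) - k * t\<close> has a nonpositive derivative.\<close>

lemma growth_comparison:
  fixes f :: "real \<Rightarrow> 'a::real_normed_vector"
  assumes C: "\<xi> < C" and k: "0 \<le> k" and \<tau>: "0 \<le> \<tau>"
    and contf: "continuous_on {0..\<tau>} f"
    and deriv: "\<And>t. 0 < t \<Longrightarrow> t < \<tau> \<Longrightarrow> (f has_vector_derivative f' t) (at t)"
    and bound: "\<And>t. 0 < t \<Longrightarrow> t < \<tau> \<Longrightarrow> norm (f' t) \<le> k * g (C + norm (f t - f 0))"
  shows "G_int g \<xi> (C + norm (f \<tau> - f 0)) \<le> G_int g \<xi> C + k * \<tau>"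
proof (cases "\<tau> = 0")
  case False
  then have "\<tau> > 0" using \<tau> by simp
  define q where "q t = k * g (C + norm (f t - f 0))" for t
  have C0: "C > 0" using C \<xi>_pos by simp
  have "continuous_on {0..\<tau>} (\<lambda>t. g (C + norm (f t - f 0)))"
    by (rule continuous_on_compose2[OF cont]) (use C0 contf in \<open>auto intro!: continuous_intros add_nonneg_nonneg\<close>)
  then have contq: "continuous_on {0..\<tau>} q"
    unfolding q_def by (intro continuous_intros)
  have q_nonneg: "0 \<le> q t" for t
    using k C0 pos[of "C + norm (f t - f 0)"] by (simp add: q_def)
  \<comment> \<open>A differentiable majorant of the displacement.\<close>
  define p where "p t = integral {0..t} q" for t
  have p_within: "(p has_real_derivative q t) (at t within {0..\<tau>})" if "t \<in> {0..\<tau>}" for t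
    unfolding p_def by (rule integral_has_real_derivative[OF contq that])
  then have contp: "continuous_on {0..\<tau>} p" by (rule DERIV_continuous_on)
  have p_deriv: "(p has_real_derivative q t) (at t)" if "0 < t" "t < \<tau>" for t
    using p_within[of t] that by (simp add: at_within_Icc_at)
  have p0: "p 0 = 0" by (simp add: p_def)
  have le_p: "norm (f t - f 0) \<le> p t" if t: "t \<in> {0..\<tau>}" for t
  proof (cases "t = 0")
    case False
    have "norm (f t - f 0) \<le> p t - p 0"
    proof (rule differentiable_bound_general[where f' = f'])
      show "continuous_on {0..t} f" "continuous_on {0..t} p"
        by (rule continuous_on_subset[OF contf] continuous_on_subset[OF contp]; use t in auto)+
      show "(p has_vector_derivative q x) (at x)" if "0 < x" "x < t" for x
        using p_deriv[of x] that t by (simp add: has_real_derivative_iff_has_vector_derivative)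
    qed (use False t deriv bound in \<open>auto simp: q_def\<close>)
    then show ?thesis by (simp add: p0)
  qed (simp add: p0)
  have p_nonneg: "0 \<le> p t" if "t \<in> {0..\<tau>}" for t
    using le_p[OF that] norm_ge_zero order_trans by blast
  have "G_int g \<xi> (C + p \<tau>) - k * \<tau> \<le> G_int g \<xi> (C + p 0) - k * 0"
  proof (rule DERIV_nonpos_imp_decreasing_open[of 0 \<tau> "\<lambda>t. G_int g \<xi> (C + p t) - k * t"])
    fix t assume t: "0 < t" "t < \<tau>"
    have d1: "((\<lambda>t. C + p t) has_real_derivative q t) (at t)"
      using p_deriv[OF t] by (auto intro!: derivative_eq_intros)
    have "\<xi> < C + p t" using C p_nonneg[of t] t by simp
    then have "((\<lambda>t. G_int g \<xi> (C + p t)) has_real_derivative 1 / g (C + p t) * q t) (at t)"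
      by (rule DERIV_chain2[OF G_int_deriv d1])
    then have "((\<lambda>t. G_int g \<xi> (C + p t) - k * t) has_real_derivative 1 / g (C + p t) * q t - k) (at t)"
      by (auto intro!: derivative_eq_intros)
    moreover have "1 / g (C + p t) * q t \<le> k"
    proof -
      have "g (C + norm (f t - f 0)) \<le> g (C + p t)"
        using le_p[of t] p_nonneg[of t] t C0 by (intro mono_onD[OF mono]) auto
      then have "q t \<le> k * g (C + p t)" unfolding q_def using k by (rule mult_left_mono)
      moreover have "0 < g (C + p t)" using pos p_nonneg[of t] t C0 by simp
      ultimately show ?thesis by (simp add: pos_divide_le_eq)
    qed
    ultimately show "\<exists>y. ((\<lambda>t. G_int g \<xi> (C + p t) - k * t) has_real_derivative y) (at t) \<and> y \<le> 0"
      by (intro exI[of _ "1 / g (C + p t) * q t - k"]) auto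
  next
    obtain b where b: "\<And>t. t \<in> {0..\<tau>} \<Longrightarrow> p t \<le> b"
      using compact_continuous_image[OF contp compact_Icc] compact_imp_bounded
      by (metis bounded_has_Sup(1) bounded_imp_bdd_above bdd_above.E image_eqI)
    show "continuous_on {0..\<tau>} (\<lambda>t. G_int g \<xi> (C + p t) - k * t)"
      by (intro continuous_intros continuous_on_compose2[OF continuous_on_G_int[of "C + b"], of "{0..\<tau>}" "\<lambda>t. C + p t"] contp)
        (use b C p_nonneg in \<open>fastforce\<close>)
  qed (use \<open>\<tau> > 0\<close> in simp)
  moreover have "G_int g \<xi> (C + norm (f \<tau> - f 0)) \<le> G_int g \<xi> (C + p \<tau>)"
    using le_p[of \<tau>] \<tau> C norm_ge_zero[of "f \<tau> - f 0"]
    by (intro G_int_mono) (simp_all del: norm_ge_zero)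
  ultimately show ?thesis by (simp add: p0)
qed simp

text \<open>The bound on the speed is assumed only while the displacement is below \<open>\<delta>\<close>. Up to the first time at which the
  displacement reaches \<open>\<delta>\<close> the comparison applies, and it contradicts the condition on \<open>\<epsilon>\<close>
  because \<open>k < \<epsilon>\<close>.\<close>

lemma growth_confinement:
  fixes f :: "real \<Rightarrow> 'a::real_normed_vector"
  assumes C: "\<xi> < C" and k: "0 \<le> k" "k < \<epsilon>" and \<delta>: "0 < \<delta>"
    and radius: "G_int g \<xi> C + \<epsilon> \<le> G_int g \<xi> (C + \<delta>)"
    and contf: "continuous_on {0..1} f"
    and deriv: "\<And>t. 0 < t \<Longrightarrow> t < 1 \<Longrightarrow> (f has_vector_derivative f' t) (at t)"
    and bound: "\<And>t. 0 < t \<Longrightarrow> t < 1 \<Longrightarrow> norm (f t - f 0) < \<delta> \<Longrightarrow>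
      norm (f' t) \<le> k * g (C + norm (f t - f 0))"
  shows "norm (f 1 - f 0) < \<delta>"
proof (rule ccontr)
  assume "\<not> norm (f 1 - f 0) < \<delta>"
  define S where "S = {0..1} \<inter> (\<lambda>t. norm (f t - f 0)) -` {\<delta>..}"
  have "closed S"
    unfolding S_def by (intro continuous_closed_preimage continuous_intros contf)
  then have "compact S" using bounded_subset[of "{0..1}" S]
    by (simp add: compact_eq_bounded_closed S_def)
  moreover have "1 \<in> S" using \<open>\<not> norm (f 1 - f 0) < \<delta>\<close> by (simp add: S_def)
  ultimately obtain \<tau> where \<tau>: "\<tau> \<in> S" "\<And>t. t \<in> S \<Longrightarrow> \<tau> \<le> t"
    using compact_attains_inf[of S] by blast
  have "G_int g \<xi> (C + norm (f \<tau> - f 0)) \<le> G_int g \<xi> C + k * \<tau>"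
  proof (rule growth_comparison[OF C k(1)])
    show "0 \<le> \<tau>" using \<tau>(1) by (simp add: S_def)
    show "continuous_on {0..\<tau>} f"
      by (rule continuous_on_subset[OF contf]) (use \<tau>(1) in \<open>auto simp: S_def\<close>)
    fix t assume t: "0 < t" "t < \<tau>"
    then have "t < 1" using \<tau>(1) by (simp add: S_def)
    with t show "(f has_vector_derivative f' t) (at t)" by (intro deriv)
    have "t \<notin> S" using \<tau>(2)[of t] t by auto
    then show "norm (f' t) \<le> k * g (C + norm (f t - f 0))"
      using t \<open>t < 1\<close> by (intro bound) (auto simp: S_def)
  qed
  moreover have "k * \<tau> \<le> k" using \<tau>(1) k(1) by (simp add: S_def mult_left_le)
  moreover have "G_int g \<xi> (C + \<delta>) \<le> G_int g \<xi> (C + norm (f \<tau> - f 0))"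
    using \<tau>(1) \<delta> C by (intro G_int_mono) (auto simp: S_def)
  ultimately show False using radius k(2) by linarith
qed

lemma admissible_radius_exists:
  assumes C: "\<xi> < C" and "0 < \<delta>" "0 < \<epsilon>W"
  shows "\<exists>\<epsilon>. admissible_radius g \<xi> C \<epsilon>W \<epsilon> \<and> G_int g \<xi> C + \<epsilon> \<le> G_int g \<xi> (C + \<delta>)"
proof -
  \<comment> \<open>The second bound also puts \<open>G_int g \<xi> C + \<epsilon>\<close> in the range of \<open>G_int\<close>, by the intermediate value theorem on \<open>{C..C + \<delta>}\<close>.\<close>
  define \<epsilon> where "\<epsilon> = min (\<epsilon>W / 2) (G_int g \<xi> (C + \<delta>) - G_int g \<xi> C)"
  have \<epsilon>: "0 < \<epsilon>" "\<epsilon> < \<epsilon>W" "G_int g \<xi> C + \<epsilon> \<le> G_int g \<xi> (C + \<delta>)"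
    using G_int_strict_mono[of C "C + \<delta>"] assms by (auto simp: \<epsilon>_def)
  obtain l where "C \<le> l" "G_int g \<xi> l = G_int g \<xi> C + \<epsilon>"
    using IVT'[of "G_int g \<xi>" C "G_int g \<xi> C + \<epsilon>" "C + \<delta>"]
      continuous_on_subset[OF continuous_on_G_int[of "C + \<delta>"], of "{C..C + \<delta>}"] \<epsilon> assms
    by auto
  then have "G_int g \<xi> C + \<epsilon> \<in> G_int g \<xi> ` {\<xi><..}" using C by (metis greaterThan_iff image_eqI order_less_le_trans)
  then show ?thesis using \<epsilon> unfolding admissible_radius_def by blast
qed

end

text \<open>Star-shapedness keeps the ray in the domain of \<open>V\<close>, so that growth along it can be estimated.\<close>

lemma star_extension_confined:
  fixes V :: "'w::complex_banach \<Rightarrow> 'u::complex_banach"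
  assumes g: "growth_bound \<G> \<xi>" and C: "\<xi> < C" "norm (V w0) \<le> C" and "0 < \<delta>"
    and radius: "G_int \<G> \<xi> C + \<epsilon> \<le> G_int \<G> \<xi> (C + \<delta>)"
    and H: "w0 \<in> H" "H \<subseteq> ball w0 \<epsilon>" "holomorphic_map_on V H"
    and star: "\<And>w s. w \<in> H \<Longrightarrow> s \<in> {0..1} \<Longrightarrow> w0 + s *\<^sub>R (w - w0) \<in> H"
    and bound: "\<And>w. w \<in> H \<Longrightarrow> V w \<in> ball (V w0) \<delta> \<Longrightarrow>
      onorm (frechet_derivative V (at w)) \<le> \<G> (norm (V w))"
    and w: "w \<in> H"
  shows "V w \<in> ball (V w0) \<delta>"
proof -
  interpret growth_bound \<G> \<xi> by (rule g)
  let ?r = "\<lambda>t. w0 + t *\<^sub>R (w - w0)"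
  let ?D = "\<lambda>t. frechet_derivative V (at (?r t))"
  have D: "(V has_derivative ?D t) (at (?r t))" if "t \<in> {0..1}" for t
    using H(3) star[OF w that] frechet_derivative_works
    unfolding holomorphic_map_on_def differentiable_def by blast
  have der: "((\<lambda>t. V (?r t)) has_vector_derivative ?D t (w - w0)) (at t)" if "t \<in> {0..1}" for t
  proof -
    have "((\<lambda>t. ?r t) has_derivative (\<lambda>h. h *\<^sub>R (w - w0))) (at t)"
      by (auto intro!: derivative_eq_intros)
    from has_derivative_compose[OF this D[OF that]] show ?thesis
      by (simp add: has_vector_derivative_def linear_cmul[OF has_derivative_linear[OF D[OF that]]])
  qed
  have "norm (V (?r 1) - V (?r 0)) < \<delta>"
  proof (rule growth_confinement[OF C(1) norm_ge_zero[of "w - w0"] _ \<open>0 < \<delta>\<close> radius])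
    show "norm (w - w0) < \<epsilon>" using w H(2) by (auto simp: dist_norm norm_minus_commute)
    show "continuous_on {0..1} (\<lambda>t. V (?r t))"
      using der has_vector_derivative_continuous by (intro continuous_at_imp_continuous_on) blast
    fix t :: real assume t: "0 < t" "t < 1"
    then have t01: "t \<in> {0..1}" by simp
    show "((\<lambda>t. V (?r t)) has_vector_derivative ?D t (w - w0)) (at t)" by (rule der[OF t01])
    assume "norm (V (?r t) - V (?r 0)) < \<delta>"
    then have "onorm (?D t) \<le> \<G> (norm (V (?r t)))"
      using bound[OF star[OF w t01]] by (simp add: dist_norm norm_minus_commute)
    also have "\<dots> \<le> \<G> (C + norm (V (?r t) - V (?r 0)))"
    proof (rule mono_onD[OF mono])
      show "norm (V (?r t)) \<le> C + norm (V (?r t) - V (?r 0))"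
        using norm_triangle_sub[of "V (?r t)" "V w0"] C(2) by simp
      have "0 \<le> C" using C(1) \<xi>_pos by linarith
      then show "C + norm (V (?r t) - V (?r 0)) \<in> {0..}" by simp
    qed simp
    finally have "onorm (?D t) * norm (w - w0) \<le> \<G> (C + norm (V (?r t) - V (?r 0))) * norm (w - w0)"
      by (rule mult_right_mono) simp
    then show "norm (?D t (w - w0)) \<le> norm (w - w0) * \<G> (C + norm (V (?r t) - V (?r 0)))"
      using onorm[OF has_derivative_bounded_linear[OF D[OF t01]], of "w - w0"]
      by (simp add: mult.commute)
  qed
  then show ?thesis by (simp add: dist_norm norm_minus_commute)
qed

section \<open>Holomorphic continuation\<close>

lemma scaleC_zero_right: "c *\<^sub>C (0::'a::complex_banach) = 0"
  using norm_scaleC[of c "0::'a"] by simp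

lemma scaleC_minus_right: "c *\<^sub>C (- x) = - (c *\<^sub>C (x::'a::complex_banach))"
  using scaleC_add_right[of c x "- x"] minus_unique[of "c *\<^sub>C x" "c *\<^sub>C (- x)"]
  by (simp add: scaleC_zero_right)

lemma implicit_derivative_complex_linear:
  fixes A :: "('w::complex_banach \<times> 'u::complex_banach) \<Rightarrow>\<^sub>L 'r::complex_banach"
  assumes A: "complex_linear (blinfun_apply A)"
    and B: "\<And>k. B (A (0, k)) = k" "\<And>y. A (0, B y) = y" and "bounded_linear B"
  shows "complex_linear (\<lambda>h. - B (A (h, 0)))"
proof -
  have A_c: "A (c *\<^sub>C h, c *\<^sub>C k) = c *\<^sub>C A (h, k)" for c h k
    using A unfolding complex_linear_def by (metis fst_conv scaleC_prod_def snd_conv)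
  have B_c: "B (c *\<^sub>C y) = c *\<^sub>C B y" for c y
  proof -
    have "A (0, c *\<^sub>C B y) = c *\<^sub>C y" using A_c[of c 0 "B y"] B(2)[of y] by (simp add: scaleC_zero_right)
    then show ?thesis using B(1) by metis
  qed
  have "bounded_linear (\<lambda>h. - B (A (h, 0)))"
    by (intro bounded_linear_minus bounded_linear_compose[OF \<open>bounded_linear B\<close>]
        bounded_linear_compose[OF blinfun.bounded_linear_right]
        bounded_linear_Pair bounded_linear_ident bounded_linear_zero)
  moreover have "- B (A (c *\<^sub>C h, 0)) = c *\<^sub>C (- B (A (h, 0)))" for c h
    using A_c[of c h 0] B_c by (metis scaleC_zero_right scaleC_minus_right)
  ultimately show ?thesis
    unfolding complex_linear_def using bounded_linear.linear by blast
qed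

text \<open>The bounds may be used for every extension to a star-shaped subset of the ball with values near
  \<open>U w0\<close>. They are first applied to \<open>U\<close> itself, to see that its graph consists of regular zeros and that it
  is the continuation near \<open>w0\<close>, and then to the continuation on all of its domain inside the ball.\<close>

lemma solution_extends_to_ball:
  fixes F :: "'w::complex_banach \<times> 'u::complex_banach \<Rightarrow> 'r::complex_banach"
  assumes C1: "C1_equation F F'" and complex: "\<And>z. complex_linear (blinfun_apply (F' z))"
    and g: "growth_bound \<G> \<xi>" and C: "\<xi> < C" "norm (U w0) \<le> C" and "0 < \<delta>"
    and radius: "G_int \<G> \<xi> C + \<epsilon> \<le> G_int \<G> \<xi> (C + \<delta>)"
    and e: "0 < e" "e \<le> \<epsilon>"
    and U: "holomorphic_map_on U (ball w0 e)" "\<And>w. w \<in> ball w0 e \<Longrightarrow> F (w, U w) = 0"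
    and deriv: "\<And>H V w. star_extension w0 e U H V \<Longrightarrow> H \<subseteq> ball w0 \<epsilon> \<Longrightarrow> w \<in> H \<Longrightarrow>
      V w \<in> ball (U w0) \<delta> \<Longrightarrow> onorm (frechet_derivative V (at w)) \<le> \<G> (norm (V w))"
    and inverse: "\<And>H V w. star_extension w0 e U H V \<Longrightarrow> H \<subseteq> ball w0 \<epsilon> \<Longrightarrow> w \<in> H \<Longrightarrow>
      V w \<in> ball (U w0) \<delta> \<Longrightarrow> \<exists>B. norm B \<le> b \<and> blinfun_inverse (C1_equation.D_u F' (w, V w)) B"
  shows "\<exists>V. star_extension w0 e U (ball w0 \<epsilon>) V \<and> V ` ball w0 \<epsilon> \<subseteq> ball (U w0) \<delta>"
proof -
  interpret C1_equation F F' by (rule C1)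
  interpret growth_bound \<G> \<xi> by (rule g)
  have confined: "V w \<in> ball (U w0) \<delta>"
    if ext: "star_extension w0 e U H V" and H: "H \<subseteq> ball w0 \<epsilon>" and w: "w \<in> H" for H V w
  proof -
    have V0: "V w0 = U w0" "w0 \<in> H" using ext e(1) by (auto simp: star_extension_def)
    have star: "w0 + s *\<^sub>R (w - w0) \<in> H" if "w \<in> H" "s \<in> {0..1}" for w s
    proof -
      have "s *\<^sub>R w + (1 - s) *\<^sub>R w0 \<in> H" using ext that unfolding star_extension_def by blast
      then show ?thesis by (simp add: algebra_simps)
    qed
    show ?thesis
      using star_extension_confined[OF g C(1) _ \<open>0 < \<delta>\<close> radius V0(2) H _ star _ w, of V]
        ext deriv[OF ext H] C(2) unfolding V0(1) by (simp add: star_extension_def)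
  qed
  let ?V = "continuation w0 (U w0)"
  define H where "H = ball w0 \<epsilon> \<inter> ray_domain w0 (U w0)"
  have star_ball: "w0 + s *\<^sub>R (w - w0) \<in> ball w0 r" if "w \<in> ball w0 r" "s \<in> {0..1}" for w s r
  proof -
    have "norm (s *\<^sub>R (w - w0)) \<le> norm (w - w0)" using that(2) by (simp add: mult_left_le_one_le)
    then show ?thesis using that(1) by (simp add: dist_norm norm_minus_commute)
  qed
  have swap: "s *\<^sub>R w + (1 - s) *\<^sub>R w0 = w0 + s *\<^sub>R (w - w0)" for s w by (simp add: algebra_simps)
  have ext0: "star_extension w0 e U (ball w0 e) U"
    unfolding star_extension_def swap using U(1) star_ball by blast
  have sub0: "ball w0 e \<subseteq> ball w0 \<epsilon>" using e(2) by (rule subset_ball)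
  have regular_U: "regular (w, U w)" if "w \<in> ball w0 e" for w
    using inverse[OF ext0 sub0 that confined[OF ext0 sub0 that]] unfolding regular_def by blast
  have lift_U: "lifted_ray w0 (U w0) w (\<lambda>t. U (w0 + t *\<^sub>R (w - w0)))" if "w \<in> ball w0 e" for w
  proof -
    have "continuous_on (ball w0 e) U"
      using U(1) unfolding holomorphic_map_on_def
      by (intro continuous_at_imp_continuous_on) (metis has_derivative_continuous)
    then have "continuous_on {0..1} (\<lambda>t. U (w0 + t *\<^sub>R (w - w0)))"
      by (rule continuous_on_compose2) (use star_ball[OF that] in \<open>auto intro!: continuous_intros\<close>)
    then show ?thesis
      unfolding lifted_ray_def using U(2) regular_U star_ball[OF that] by simp
  qed
  have V_U: "?V w = U w" "w \<in> H" if "w \<in> ball w0 e" for w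
    using continuation_eq[OF lift_U[OF that]] lift_U[OF that] sub0 that
    by (auto simp: H_def ray_domain_def)
  have "star_extension w0 e U H ?V"
    unfolding star_extension_def swap
  proof (intro conjI ballI)
    show "open H" unfolding H_def by (intro open_Int open_ball open_ray_domain)
    show "holomorphic_map_on ?V H"
      unfolding holomorphic_map_on_def
    proof
      fix w assume "w \<in> H"
      then have w: "w \<in> ray_domain w0 (U w0)" by (simp add: H_def)
      obtain B where B: "blinfun_inverse (D_u (w, ?V w)) B"
        using ray_domain_zero(2)[OF w] unfolding regular_def by blast
      have "complex_linear (\<lambda>h. - B (F' (w, ?V w) (h, 0)))"
        using B by (intro implicit_derivative_complex_linear complex blinfun.bounded_linear_right)
          (auto simp: blinfun_inverse_def)
      then show "\<exists>D. (?V has_derivative D) (at w) \<and> complex_linear D"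
        using continuation_has_derivative[OF w B] by blast
    qed
    show "w0 + s *\<^sub>R (w - w0) \<in> H" if "w \<in> H" "s \<in> {0..1}" for w s
      using that star_ball ray_domain_star unfolding H_def by blast
  qed (use V_U in auto)
  note ext = this
  have H_sub: "H \<subseteq> ball w0 \<epsilon>" by (simp add: H_def)
  have "ball w0 \<epsilon> \<subseteq> ray_domain w0 (U w0)"
  proof (rule ball_subset_ray_domain)
    have "w0 \<in> ball w0 e" using e(1) by simp
    then show "F (w0, U w0) = 0" "regular (w0, U w0)" by (rule U(2), rule regular_U)
    fix w assume "w \<in> ball w0 \<epsilon> \<inter> ray_domain w0 (U w0)"
    then have w: "w \<in> H" by (simp add: H_def)
    note conf = confined[OF ext H_sub w]
    show "\<exists>B. norm B \<le> b \<and> blinfun_inverse (D_u (w, ?V w)) B"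
      by (rule inverse[OF ext H_sub w conf])
    have "norm (?V w) \<le> C + \<delta>"
      using conf C(2) norm_triangle_sub[of "?V w" "U w0"] by (simp add: dist_norm norm_minus_commute)
    then have "\<G> (norm (?V w)) \<le> \<G> (C + \<delta>)"
      using C(1) \<xi>_pos \<open>0 < \<delta>\<close> by (intro mono_onD[OF mono]) auto
    then show "onorm (frechet_derivative ?V (at w)) \<le> \<G> (C + \<delta>)"
      using deriv[OF ext H_sub w conf] by linarith
  qed
  then have "H = ball w0 \<epsilon>" by (auto simp: H_def)
  then show ?thesis using ext confined[OF ext H_sub] by blast
qed

theorem theorem5:
  fixes coord :: "'x::{banach, second_countable_topology} \<Rightarrow> nat \<Rightarrow> real"
    and \<R> :: "'w::complex_banach \<times> 'u::complex_banach \<Rightarrow> 'r::complex_banach"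
    and W\<^sub>R :: "'w set" and U\<^sub>R :: "'u set"
    and Wy :: "'x \<Rightarrow> 'w" and u :: "'x \<Rightarrow> 'u"
    and \<epsilon>\<^sub>y :: "'x \<Rightarrow> real" and \<U> :: "'x \<Rightarrow> 'w \<Rightarrow> 'u"
    and \<G>\<^sub>1 \<G>\<^sub>2 \<G> :: "real \<Rightarrow> real"
    and C\<^sub>r \<epsilon>\<^sub>W \<epsilon>\<^sub>u \<xi> :: real
  assumes "sequence_space coord"
    and "real_banach_subspace W\<^sub>R" and "real_banach_subspace U\<^sub>R"
    and "\<And>y. Wy y \<in> W\<^sub>R"
    and "assumption1 \<R> U\<^sub>R Wy u C\<^sub>r"
    and "assumption2 \<R> W\<^sub>R U\<^sub>R"
    and "solution_operator \<R> Wy u \<epsilon>\<^sub>y \<U>"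
    and "\<And>y. \<epsilon>\<^sub>y y \<le> \<epsilon>\<^sub>W"
    and "assumption3 \<R> Wy \<epsilon>\<^sub>y \<U> \<epsilon>\<^sub>W \<epsilon>\<^sub>u \<G>\<^sub>1 \<G>\<^sub>2"
    and "derivative_bound Wy \<epsilon>\<^sub>y \<U> \<epsilon>\<^sub>W \<epsilon>\<^sub>u \<G>"
    and "0 < \<xi>" and "\<xi> < C\<^sub>r"
  shows "(\<exists>\<epsilon>. admissible_radius \<G> \<xi> C\<^sub>r \<epsilon>\<^sub>W \<epsilon> \<and>
      G_int \<G> \<xi> C\<^sub>r + \<epsilon> \<le> G_int \<G> \<xi> (C\<^sub>r + \<epsilon>\<^sub>u)) \<and>
    (\<forall>\<epsilon>. admissible_radius \<G> \<xi> C\<^sub>r \<epsilon>\<^sub>W \<epsilon> \<and>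
      G_int \<G> \<xi> C\<^sub>r + \<epsilon> \<le> G_int \<G> \<xi> (C\<^sub>r + \<epsilon>\<^sub>u) \<longrightarrow>
      (\<exists>C\<^sub>\<epsilon>>0. \<forall>y. \<exists>V.
         is_H_set (Wy y) \<epsilon>\<^sub>W \<epsilon>\<^sub>u (min (\<epsilon>\<^sub>y y) \<epsilon>) (\<U> y) (ball (Wy y) \<epsilon>) V \<and>
         (\<forall>W\<in>ball (Wy y) \<epsilon>. norm (V W) \<le> C\<^sub>\<epsilon>)))"
proof -
  obtain R' where R': "\<And>z. (\<R> has_derivative blinfun_apply (R' z)) (at z)"
      "\<And>z. complex_linear (blinfun_apply (R' z))" "continuous_on UNIV R'"
    using assms(6) unfolding assumption2_def continuously_complex_differentiable_def by blast
  interpret C1_equation \<R> R' by unfold_locales (rule R')+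
  interpret growth_bound \<G> \<xi>
    using assms(10,11) by unfold_locales (simp_all add: derivative_bound_def)
  have pos3: "0 < \<epsilon>\<^sub>W" "0 < \<epsilon>\<^sub>u" and cont3: "continuous_on {0..} \<G>\<^sub>2"
    using assms(9) by (simp_all add: assumption3_def)
  \<comment> \<open>The confined values have norm at most \<open>C\<^sub>r + \<epsilon>\<^sub>u\<close>, so one bound on the inverses serves all \<open>y\<close>.\<close>
  obtain b where b: "\<And>s. s \<in> {0..C\<^sub>r + \<epsilon>\<^sub>u} \<Longrightarrow> \<G>\<^sub>2 s \<le> b"
  proof -
    have "bounded (\<G>\<^sub>2 ` {0..C\<^sub>r + \<epsilon>\<^sub>u})"
      by (intro compact_imp_bounded compact_continuous_image continuous_on_subset[OF cont3]) auto
    then show ?thesis using that unfolding bounded_iff by (metis abs_le_D1 imageI real_norm_def)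
  qed
  have "\<exists>C\<^sub>\<epsilon>>0. \<forall>y. \<exists>V.
         is_H_set (Wy y) \<epsilon>\<^sub>W \<epsilon>\<^sub>u (min (\<epsilon>\<^sub>y y) \<epsilon>) (\<U> y) (ball (Wy y) \<epsilon>) V \<and>
         (\<forall>W\<in>ball (Wy y) \<epsilon>. norm (V W) \<le> C\<^sub>\<epsilon>)"
    if adm: "admissible_radius \<G> \<xi> C\<^sub>r \<epsilon>\<^sub>W \<epsilon>"
      and radius: "G_int \<G> \<xi> C\<^sub>r + \<epsilon> \<le> G_int \<G> \<xi> (C\<^sub>r + \<epsilon>\<^sub>u)" for \<epsilon>
  proof -
    have \<epsilon>: "0 < \<epsilon>" "\<epsilon> < \<epsilon>\<^sub>W" using adm by (simp_all add: admissible_radius_def)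
    have "\<exists>V. is_H_set (Wy y) \<epsilon>\<^sub>W \<epsilon>\<^sub>u (min (\<epsilon>\<^sub>y y) \<epsilon>) (\<U> y) (ball (Wy y) \<epsilon>) V \<and>
         (\<forall>W\<in>ball (Wy y) \<epsilon>. norm (V W) \<le> C\<^sub>r + \<epsilon>\<^sub>u)" for y
    proof -
      \<comment> \<open>If \<open>\<epsilon>\<^sub>y y > \<epsilon>\<close>, the initial ball has to be shrunk to fit into \<open>ball (Wy y) \<epsilon>\<close>.\<close>
      define e where "e = min (\<epsilon>\<^sub>y y) \<epsilon>"
      have sol: "\<epsilon>\<^sub>y y > 0" "holomorphic_map_on (\<U> y) (ball (Wy y) (\<epsilon>\<^sub>y y))" "\<U> y (Wy y) = u y"
        "\<And>W. W \<in> ball (Wy y) (\<epsilon>\<^sub>y y) \<Longrightarrow> \<R> (W, \<U> y W) = 0"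
        using assms(7) by (auto simp: solution_operator_def)
      have e: "0 < e" "e \<le> \<epsilon>" "e \<le> \<epsilon>\<^sub>y y" using sol(1) \<epsilon>(1) by (auto simp: e_def)
      have norm_u: "norm (\<U> y (Wy y)) \<le> C\<^sub>r"
        using assms(5) sol(3) by (simp add: assumption1_def)
      have scope: "in_scope Wy \<epsilon>\<^sub>y \<U> \<epsilon>\<^sub>W \<epsilon>\<^sub>u y V W"
        if "star_extension (Wy y) e (\<U> y) H V" "H \<subseteq> ball (Wy y) \<epsilon>" "W \<in> H"
          "V W \<in> ball (\<U> y (Wy y)) \<epsilon>\<^sub>u" for H V W
        unfolding in_scope_def
        using that e subset_ball[of \<epsilon> \<epsilon>\<^sub>W "Wy y"] \<epsilon>(2) by (meson less_imp_le order_trans)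
      have norm_V: "norm v \<le> C\<^sub>r + \<epsilon>\<^sub>u" if "v \<in> ball (\<U> y (Wy y)) \<epsilon>\<^sub>u" for v
        using that norm_u norm_triangle_sub[of v "\<U> y (Wy y)"] by (simp add: dist_norm norm_minus_commute)
      have "\<exists>V. star_extension (Wy y) e (\<U> y) (ball (Wy y) \<epsilon>) V \<and>
          V ` ball (Wy y) \<epsilon> \<subseteq> ball (\<U> y (Wy y)) \<epsilon>\<^sub>u"
      proof (rule solution_extends_to_ball[where b = b and C = C\<^sub>r and \<G> = \<G> and \<xi> = \<xi>])
        show "C1_equation \<R> R'" "growth_bound \<G> \<xi>" by unfold_locales
        show "holomorphic_map_on (\<U> y) (ball (Wy y) e)"
          using sol(2) subset_ball[OF e(3)] unfolding holomorphic_map_on_def by blast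
        show "\<R> (W, \<U> y W) = 0" if "W \<in> ball (Wy y) e" for W
          using sol(4) subset_ball[OF e(3)] that by blast
      next
        fix H V W
        assume *: "star_extension (Wy y) e (\<U> y) H V" "H \<subseteq> ball (Wy y) \<epsilon>" "W \<in> H"
          "V W \<in> ball (\<U> y (Wy y)) \<epsilon>\<^sub>u"
        note sc = scope[OF *]
        show "onorm (frechet_derivative V (at W)) \<le> \<G> (norm (V W))"
          using assms(10) sc unfolding derivative_bound_def by blast
        have "homeomorphism UNIV UNIV (partial_u \<R> W (V W)) (inv (partial_u \<R> W (V W)))"
          "onorm (inv (partial_u \<R> W (V W))) \<le> \<G>\<^sub>2 (norm (V W))"
          using assms(9) sc unfolding assumption3_def by blast+
        moreover have "\<G>\<^sub>2 (norm (V W)) \<le> b" using b norm_V[OF *(4)] by simp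
        ultimately show "\<exists>B. norm B \<le> b \<and> blinfun_inverse (D_u (W, V W)) B"
          unfolding partial_u_def frechet_derivative_section
          by (intro linear_homeomorphism_blinfun_inverse) auto
      qed (use R' assms(11,12) norm_u pos3 radius e in auto)
      then obtain V where V: "star_extension (Wy y) e (\<U> y) (ball (Wy y) \<epsilon>) V"
          "V ` ball (Wy y) \<epsilon> \<subseteq> ball (\<U> y (Wy y)) \<epsilon>\<^sub>u"
        by blast
      have "V (Wy y) = \<U> y (Wy y)" using V(1) e(1) by (simp add: star_extension_def)
      then have "is_H_set (Wy y) \<epsilon>\<^sub>W \<epsilon>\<^sub>u e (\<U> y) (ball (Wy y) \<epsilon>) V"
        unfolding is_H_set_def using V subset_ball[of \<epsilon> \<epsilon>\<^sub>W "Wy y"] \<epsilon>(2) by auto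
      moreover have "\<forall>W\<in>ball (Wy y) \<epsilon>. norm (V W) \<le> C\<^sub>r + \<epsilon>\<^sub>u"
        using V(2) norm_V by blast
      ultimately show ?thesis unfolding e_def by blast
    qed
    moreover have "0 < C\<^sub>r + \<epsilon>\<^sub>u" using assms(11,12) pos3 by simp
    ultimately show ?thesis by blast
  qed
  then show ?thesis
    using admissible_radius_exists[OF \<open>\<xi> < C\<^sub>r\<close> pos3(2,1)] by blast
qed

end
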